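(* Let $G$ be a finite group and $p$ a prime dividing $|G|$. Assume that for any two distinct Sylow $p$-subgroups $P$ and $Q$ of $G$, the inequality $|P\cap Q|\le |Z^*(P)|$ is satisfied. Then, for a Sylow $p$-subgroup $P$ of $G$, $N_G(P)$ controls $p$-transfer in $G$.
   Context: All groups are finite. $Z^*(P)=\bigcap_{H\le P}N_P(H)$ denotes the norm of $P$ (the intersection of the normalizers in $P$ of all subgroups of $P$). $A^p(G)$ denotes the smallest normal subgroup of $G$ whose quotient is an abelian $p$-group. If $N\le G$ has index coprime to $p$, then $N$ controls $p$-transfer in $G$ if $N/A^p(N)\cong G/A^p(G)$. *)

theory Defs
  imports "HOL-Algebra.Sylow" "HOL-Algebra.Group_Action"
begin

text \<open>A subgroup \<open>H\<close> of \<open>G\<close> is regarded as a group in its own right by passing to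
  \<open>G\<lparr>carrier := H\<rparr>\<close>.\<close>

definition sylow_subgroup :: "nat \<Rightarrow> ('a, 'b) monoid_scheme \<Rightarrow> 'a set \<Rightarrow> bool" where
  "sylow_subgroup p G P \<longleftrightarrow> subgroup P G \<and> card P = p ^ multiplicity p (order G)"

definition group_norm :: "('a, 'b) monoid_scheme \<Rightarrow> 'a set" where
  "group_norm G = (\<Inter>H \<in> {H. subgroup H G}. normalizer G H)"

definition abelian_p_quotient :: "nat \<Rightarrow> ('a, 'b) monoid_scheme \<Rightarrow> 'a set \<Rightarrow> bool" where
  "abelian_p_quotient p G N \<longleftrightarrow>
     N \<lhd> G \<and> comm_group (G Mod N) \<and> (\<exists>k. order (G Mod N) = p ^ k)"

text \<open>The order on sets is inclusion. For a finite group and a prime \<open>p\<close> the least element exists;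
  see \<open>p_abelian_residual_least\<close> below.\<close>

definition p_abelian_residual :: "nat \<Rightarrow> ('a, 'b) monoid_scheme \<Rightarrow> 'a set" where
  "p_abelian_residual p G = (LEAST N. abelian_p_quotient p G N)"

definition controls_p_transfer :: "nat \<Rightarrow> ('a, 'b) monoid_scheme \<Rightarrow> 'a set \<Rightarrow> bool" where
  "controls_p_transfer p G N \<longleftrightarrow>
     subgroup N G \<and> coprime (card (rcosets\<^bsub>G\<^esub> N)) p \<and>
     (G\<lparr>carrier := N\<rparr> Mod p_abelian_residual p (G\<lparr>carrier := N\<rparr>)) \<cong> (G Mod p_abelian_residual p G)"


lemma (in group) abelian_p_quotient_Int:
  assumes fin: "finite (carrier G)" and p: "Factorial_Ring.prime p"
    and M: "abelian_p_quotient p G M" and N: "abelian_p_quotient p G N"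
  shows "abelian_p_quotient p G (M \<inter> N)"
proof -
  from M N obtain a b where
    MG: "M \<lhd> G" and Mc: "comm_group (G Mod M)" and a: "order (G Mod M) = p ^ a" and
    NG: "N \<lhd> G" and Nc: "comm_group (G Mod N)" and b: "order (G Mod N) = p ^ b"
    unfolding abelian_p_quotient_def by blast
  interpret M: normal M G by (rule MG)
  interpret N: normal N G by (rule NG)
  let ?D = "(G Mod M) \<times>\<times> (G Mod N)"
  let ?h = "\<lambda>g. (M #> g, N #> g)"
  interpret GM: comm_group "G Mod M" by (rule Mc)
  interpret GN: comm_group "G Mod N" by (rule Nc)
  have gD: "group ?D" by (rule DirProd_group) unfold_locales
  interpret D: group ?D by (rule gD)
  have hom: "?h \<in> hom G ?D"
    using M.r_coset_hom_Mod N.r_coset_hom_Mod by (auto simp: hom_def)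
  interpret h: group_hom G ?D ?h
    by (simp add: group_hom_def group_hom_axioms_def hom gD is_group)
  have ker: "kernel G ?D ?h = M \<inter> N"
  proof -
    have "M #> x = M \<longleftrightarrow> x \<in> M" if "x \<in> carrier G" for x
      using that M.rcos_const rcos_self[OF _ M.is_subgroup] by blast
    moreover have "N #> x = N \<longleftrightarrow> x \<in> N" if "x \<in> carrier G" for x
      using that N.rcos_const rcos_self[OF _ N.is_subgroup] by blast
    ultimately show ?thesis using M.mem_carrier
      by (auto simp: kernel_def FactGroup_def DirProd_def M.rcos_const N.rcos_const)
  qed
  have nrm: "(M \<inter> N) \<lhd> G" using h.normal_kernel ker by simp
  interpret MN: normal "M \<inter> N" G by (rule nrm)
  interpret Q: group "G Mod (M \<inter> N)" by (rule MN.factorgroup_is_group)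
  define f where "f = (\<lambda>X. the_elem (?h ` X))"
  have f: "f \<in> hom (G Mod (M \<inter> N)) ?D" "inj_on f (carrier (G Mod (M \<inter> N)))"
    using h.FactGroup_hom h.FactGroup_inj_on unfolding ker f_def by auto
  have com: "comm_group (G Mod (M \<inter> N))"
  proof (rule Q.group_comm_groupI)
    fix x y assume x: "x \<in> carrier (G Mod (M \<inter> N))" and y: "y \<in> carrier (G Mod (M \<inter> N))"
    have fx: "f x \<in> carrier ?D" "f y \<in> carrier ?D" using f(1) x y by (auto simp: hom_def)
    have "f x \<otimes>\<^bsub>?D\<^esub> f y = f y \<otimes>\<^bsub>?D\<^esub> f x"
      using fx GM.m_comm GN.m_comm by (cases "f x"; cases "f y") auto
    then have "f (x \<otimes>\<^bsub>G Mod (M \<inter> N)\<^esub> y) = f (y \<otimes>\<^bsub>G Mod (M \<inter> N)\<^esub> x)"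
      using hom_mult[OF f(1) x y] hom_mult[OF f(1) y x] by metis
    then show "x \<otimes>\<^bsub>G Mod (M \<inter> N)\<^esub> y = y \<otimes>\<^bsub>G Mod (M \<inter> N)\<^esub> x"
      using f(2) x y by (meson Q.m_closed inj_onD)
  qed
  interpret f: group_hom "G Mod (M \<inter> N)" ?D f
    by (simp add: group_hom_def group_hom_axioms_def f gD Q.is_group)
  have "card (rcosets\<^bsub>?D\<^esub> (f ` carrier (G Mod (M \<inter> N)))) * card (f ` carrier (G Mod (M \<inter> N))) = order ?D"
    using D.lagrange[OF f.img_is_subgroup] by simp
  then have "order (G Mod (M \<inter> N)) dvd order ?D"
    using card_image[OF f(2)] by (metis dvd_triv_right order_def)
  also have "order ?D = p ^ (a + b)"
    using a b by (simp add: order_def DirProd_def card_cartesian_product power_add)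
  finally have "\<exists>k. order (G Mod (M \<inter> N)) = p ^ k"
    using p divides_primepow_nat by blast
  then show ?thesis using nrm com by (simp add: abelian_p_quotient_def)
qed

lemma (in group) p_abelian_residual_least:
  assumes fin: "finite (carrier G)" and p: "Factorial_Ring.prime p"
  shows "abelian_p_quotient p G (p_abelian_residual p G)"
    and "\<And>N. abelian_p_quotient p G N \<Longrightarrow> p_abelian_residual p G \<subseteq> N"
proof -
  have top: "abelian_p_quotient p G (carrier G)"
  proof -
    have n: "carrier G \<lhd> G" using normal_invI subgroup_self by auto
    have c: "carrier (G Mod carrier G) = {carrier G}"
      unfolding FactGroup_def RCOSETS_def using coset_join2[OF _ subgroup_self]
      by (auto) 
    interpret Q: group "G Mod carrier G" by (rule normal.factorgroup_is_group[OF n])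
    have "comm_group (G Mod carrier G)"
      by (rule Q.group_comm_groupI) (simp add: c)
    moreover have "order (G Mod carrier G) = p ^ 0" by (simp add: order_def c)
    ultimately show ?thesis using n unfolding abelian_p_quotient_def by blast
  qed
  obtain L where L: "abelian_p_quotient p G L"
    and min: "\<And>N. abelian_p_quotient p G N \<Longrightarrow> card L \<le> card N"
    using ex_has_least_nat[of "abelian_p_quotient p G" "carrier G" card] top by blast
  have finL: "finite L"
    using L fin unfolding abelian_p_quotient_def
    by (meson finite_subset normal_imp_subgroup subgroup.subset)
  have sub: "L \<subseteq> N" if "abelian_p_quotient p G N" for N
  proof -
    have "card L \<le> card (L \<inter> N)" using min abelian_p_quotient_Int[OF fin p L that] by blast
    then have "L \<inter> N = L" using finL by (meson card_seteq inf_le1)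
    then show ?thesis by blast
  qed
  have eq: "p_abelian_residual p G = L"
    unfolding p_abelian_residual_def by (rule Least_equality) (use L sub in auto)
  show "abelian_p_quotient p G (p_abelian_residual p G)" using L eq by simp
  show "\<And>N. abelian_p_quotient p G N \<Longrightarrow> p_abelian_residual p G \<subseteq> N" using sub eq by simp
qed

end

theory Submission
  imports Defs Complex_Main "HOL-Algebra.Zassenhaus" "HOL-Number_Theory.Residues"
begin

text \<open>Let \<open>N\<close> be the normalizer of \<open>P\<close> and \<open>A\<close> the largest abelian \<open>p\<close>-quotient of \<open>N\<close>. The projection
  of \<open>N\<close> onto the largest abelian \<open>p\<close>-quotient of \<open>G\<close> is surjective, as \<open>N\<close> has index prime to \<open>p\<close>,
  and it factors through \<open>A\<close>. So it suffices to find a surjective homomorphism from \<open>G\<close> onto \<open>A\<close>.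
  The transfer \<open>V\<close> is one (\<open>transfer_from_sylow_normalizer_surj\<close>).

  Suppose that \<open>V\<close> is not surjective. Then a nontrivial character of \<open>A\<close> of order \<open>p\<close> is trivial on
  the image of \<open>V\<close>; let \<open>\<phi>\<close> be its pullback to \<open>N\<close>. It is nontrivial on \<open>P\<close>, and we choose
  \<open>u \<in> P\<close> of least order with \<open>\<phi> u \<noteq> 1\<close>. The character of \<open>V u\<close> is a product over
  the cycles of \<open>u\<close> on the cosets of \<open>N\<close>. A cycle of length \<open>r > 1\<close> contributes the value of
  \<open>\<phi>\<close> at a conjugate of \<open>u [^] r\<close>, which is \<open>1\<close> by the choice of \<open>u\<close>. A fixed coset of \<open>x\<close>
  contributes \<open>\<phi> (x \<otimes> u \<otimes> inv x)\<close>, and for the coset \<open>N\<close> this is \<open>\<phi> u\<close>.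

  The remaining fixed cosets are collected by orbits of \<open>P\<close>. The stabilizer \<open>D\<close> of the coset of \<open>x\<close>
  in \<open>P\<close> is the intersection of \<open>P\<close> with another Sylow subgroup, so \<open>D \<noteq> P\<close> and the order of
  \<open>D\<close> is at most that of the norm \<open>Z\<close> of \<open>P\<close>. The crucial point
  (\<open>normalizing_element_cancelling_chars\<close>) is that there is a \<open>t\<close> in \<open>P\<close>, outside \<open>D\<close>, normalizing
  \<open>D\<close> and with \<open>p\<close>-th power in \<open>D\<close>, such that for every \<open>v \<in> D\<close> and every character of \<open>D\<close> of
  order \<open>p\<close> the product of the values at the \<open>p\<close> conjugates of \<open>v\<close> by powers of \<open>t\<close> is \<open>1\<close>. Left
  multiplication by \<open>t\<close> on the cosets of \<open>D\<close> in \<open>P\<close> then cuts the orbit into cycles of length \<open>p\<close> on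
  which the factors cancel. Altogether the character of \<open>V u\<close> equals \<open>\<phi> u \<noteq> 1\<close>, a
  contradiction.

  To find \<open>t\<close>, note that an element of \<open>Z\<close> conjugates every element of \<open>P\<close> to one of its powers. If
  \<open>Z\<close> is not contained in \<open>D\<close>, a suitable \<open>t \<in> Z\<close> fixes the value of every such character at
  every \<open>v\<close>. Otherwise \<open>D = Z\<close> by the bound on the order, and \<open>t\<close> may be any element outside \<open>D\<close>
  with \<open>p\<close>-th power in \<open>D\<close>: the commutator \<open>c\<close> of \<open>t\<close> and \<open>v\<close> is a power of \<open>t\<close>, so the conjugates
  of \<open>v\<close> are \<open>c [^] i \<otimes> v\<close>, and the product of the character values is the value at \<open>c\<close> to
  the power \<open>p * (p - 1) div 2\<close>. This is \<open>1\<close> for odd \<open>p\<close>; for \<open>p = 2\<close> the value at \<open>c\<close> itself turns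
  out to be \<open>1\<close>.\<close>

section \<open>Roots of unity and products along cycles\<close>

text \<open>Modulo \<open>p\<close> the exponents \<open>k ^ (p ^ n)\<close> and \<open>k\<close> agree by Fermat's little theorem.\<close>

lemma root_of_unity_power_fermat:
  fixes c :: complex and k n p :: nat
  assumes "Factorial_Ring.prime p" "c ^ p = 1"
  shows "c ^ (k ^ (p ^ n)) = c ^ k"
proof -
  have per: "c ^ a = c ^ (a mod p)" for a :: nat
  proof -
    have "c ^ a = c ^ (p * (a div p) + a mod p)" by simp
    also have "\<dots> = (c ^ p) ^ (a div p) * c ^ (a mod p)" by (simp only: power_add power_mult)
    finally show ?thesis using assms(2) by simp
  qed
  have step: "[k ^ p = k] (mod p)" for k
  proof (cases "p dvd k")
    case True
    then have "p dvd k ^ p" using assms(1) by (meson dvd_power dvd_trans prime_gt_0_nat)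
    then show ?thesis using True by (simp add: cong_def)
  next
    case False
    have "[k ^ (p - 1) * k = 1 * k] (mod p)"
      by (rule cong_mult[OF fermat_theorem[OF assms(1) False] cong_refl])
    then show ?thesis using prime_gt_0_nat[OF assms(1)] by (simp add: power_eq_if mult.commute)
  qed
  have "[k ^ (p ^ n) = k] (mod p)"
  proof (induction n)
    case (Suc n)
    have "k ^ (p ^ Suc n) = (k ^ (p ^ n)) ^ p" by (simp add: power_mult[symmetric] mult.commute)
    then show ?case using cong_trans[OF step Suc] by simp
  qed simp
  then show ?thesis using per by (metis cong_def)
qed

text \<open>The exponents sum to \<open>p * ((p - 1) div 2)\<close>, a multiple of \<open>p\<close> for odd \<open>p\<close>. For \<open>p = 2\<close> the product
  is \<open>c\<close>, which is why \<open>2\<close> needs a separate argument later.\<close>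

lemma prod_powers_prime_period:
  fixes c :: complex
  assumes "Factorial_Ring.prime p" "c ^ p = 1" "p \<noteq> 2"
  shows "(\<Prod>i<p. c ^ i) = 1"
proof -
  have "odd p" using assms by (simp add: prime_odd_nat prime_ge_2_nat le_neq_implies_less)
  then have ev: "even (p - 1)" by simp
  have "(\<Prod>i<p. c ^ i) = c ^ (\<Sum>i<p. i)" by (simp add: power_sum)
  also have "(\<Sum>i<p. i) = p * ((p - 1) div 2)"
  proof -
    have "(\<Sum>i<p. i) = p * (p - 1) div 2"
      using gauss_sum_nat[of "p - 1"] prime_gt_0_nat[OF assms(1)]
      by (metis Suc_pred' atLeast0AtMost lessThan_Suc_atMost mult.commute)
    then show ?thesis using ev by (simp add: div_mult_swap)
  qed
  finally show ?thesis using assms(2) by (simp add: power_mult)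
qed

lemma nontrivial_root_of_unity:
  assumes "Factorial_Ring.prime (p::nat)"
  obtains \<omega> :: complex where "\<omega> ^ p = 1" "\<omega> \<noteq> 1"
proof -
  have c: "card {z::complex. z ^ p = 1} = p"
    using card_roots_unity_eq[of p] prime_gt_0_nat[OF assms] by simp
  have "\<not> {z::complex. z ^ p = 1} \<subseteq> {1}"
  proof
    assume "{z::complex. z ^ p = 1} \<subseteq> {1}"
    then have "card {z::complex. z ^ p = 1} \<le> card {1::complex}" by (rule card_mono[rotated]) simp
    then have "p \<le> 1" unfolding c by simp
    then show False using prime_ge_2_nat[OF assms] by simp
  qed
  then show thesis using that by blast
qed

text \<open>The set splits into the cycles of the permutation \<open>\<tau>\<close>. Both uses are in the evaluation of the
  transfer: for the cycles of an element on cosets, and for cycles of length \<open>p\<close> inside an orbit of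
  the Sylow subgroup.\<close>

lemma prod_eq_1_by_cycles:
  fixes h :: "'x \<Rightarrow> complex"
  assumes fin: "finite X" and N: "N > 0"
    and into: "\<And>y. y \<in> X \<Longrightarrow> \<tau> y \<in> X"
    and per: "\<And>y. y \<in> X \<Longrightarrow> (\<tau> ^^ N) y = y"
    and cyc: "\<And>y r. y \<in> X \<Longrightarrow> r > 0 \<Longrightarrow> (\<tau> ^^ r) y = y \<Longrightarrow>
        (\<And>j. 0 < j \<Longrightarrow> j < r \<Longrightarrow> (\<tau> ^^ j) y \<noteq> y) \<Longrightarrow> (\<Prod>i<r. h ((\<tau> ^^ i) y)) = 1"
  shows "prod h X = 1"
proof -
  let ?O = "\<lambda>y. range (\<lambda>i. (\<tau> ^^ i) y)"
  have inX: "(\<tau> ^^ i) y \<in> X" if "y \<in> X" for i y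
    by (induction i) (use that into in auto)
  have perm: "(\<tau> ^^ (N * m)) y = y" if "y \<in> X" for y m
    using per[OF that] by (induction m) (simp_all add: funpow_add)
  have same: "?O z = ?O y" if that': "y \<in> X" "z \<in> ?O y" for y z
  proof -
    obtain i where z: "z = (\<tau> ^^ i) y" using that' by auto
    have "?O z \<subseteq> ?O y" unfolding z by (auto simp: funpow_add[symmetric, THEN fun_cong, simplified comp_apply])
    moreover have "(\<tau> ^^ j) y \<in> ?O z" for j
    proof -
      have "(\<tau> ^^ (N * i - i + j)) z = (\<tau> ^^ (N * i - i + j + i)) y"
        unfolding z by (simp add: funpow_add)
      also have "N * i - i + j + i = j + N * i" using N by (cases N) auto
      finally have "(\<tau> ^^ (N * i - i + j)) z = (\<tau> ^^ j) y"
        using perm[OF that'(1)] by (simp add: funpow_add)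
      then show ?thesis by (metis rangeI)
    qed
    ultimately show ?thesis by blast
  qed
  \<comment> \<open>A fibre of \<open>?O\<close> is one cycle; its length is the least period of any of its points.\<close>
  have "prod h {x \<in> X. ?O x = O'} = 1" if O': "O' \<in> ?O ` X" for O'
  proof -
    obtain y where y: "y \<in> X" "O' = ?O y" using O' by auto
    define r where "r = (LEAST r. r > 0 \<and> (\<tau> ^^ r) y = y)"
    have r: "r > 0 \<and> (\<tau> ^^ r) y = y"
      unfolding r_def by (rule LeastI[of _ N]) (use N per y in auto)
    have rmin: "(\<tau> ^^ j) y \<noteq> y" if "0 < j" "j < r" for j
      using not_less_Least[of j "\<lambda>r. r > 0 \<and> (\<tau> ^^ r) y = y"] that unfolding r_def by auto
    have md: "(\<tau> ^^ i) y = (\<tau> ^^ (i mod r)) y" for i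
      using r by (simp add: funpow_mod_eq)
    have "{x \<in> X. ?O x = O'} = ?O y"
    proof -
      have self: "x \<in> ?O x" for x by (rule range_eqI[of _ _ 0]) simp
      show ?thesis
      proof (intro equalityI subsetI)
        fix x assume "x \<in> {x \<in> X. ?O x = O'}"
        then show "x \<in> ?O y" using self[of x] y(2) by simp
      next
        fix x assume x: "x \<in> ?O y"
        then have "x \<in> X" using inX[OF y(1)] by auto
        then show "x \<in> {x \<in> X. ?O x = O'}" using same[OF y(1) x] y(2) by simp
      qed
    qed
    also have "\<dots> = (\<lambda>i. (\<tau> ^^ i) y) ` {..<r}"
    proof -
      have "(\<tau> ^^ i) y \<in> (\<lambda>i. (\<tau> ^^ i) y) ` {..<r}" for i
        by (subst md) (use r in auto)
      then show ?thesis by auto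
    qed
    finally have fib: "{x \<in> X. ?O x = O'} = (\<lambda>i. (\<tau> ^^ i) y) ` {..<r}" .
    have "(\<tau> ^^ i) y \<noteq> (\<tau> ^^ j) y" if ij: "i < j" "j < r" for i j
    proof
      assume e: "(\<tau> ^^ i) y = (\<tau> ^^ j) y"
      have "(\<tau> ^^ (r - j + i)) y = (\<tau> ^^ (r - j + j)) y" using e by (simp only: funpow_add comp_apply)
      moreover have "0 < r - j + i" "r - j + i < r" "r - j + j = r" using ij by auto
      ultimately show False using rmin[of "r - j + i"] r by simp
    qed
    then have "inj_on (\<lambda>i. (\<tau> ^^ i) y) {..<r}"
      by (metis (mono_tags, lifting) inj_onI lessThan_iff linorder_neqE_nat)
    then show ?thesis unfolding fib by (simp add: prod.reindex cyc[OF y(1)] r rmin)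
  qed
  then show ?thesis
    using prod.image_gen[OF fin, of h ?O] by simp
qed

section \<open>Characters of prime order\<close>

text \<open>A homomorphism from \<open>S\<close> to the complex \<open>p\<close>-th roots of unity. The set \<open>S\<close> is a parameter of its
  own so that characters of several subgroups can be used within one group structure.\<close>

definition linear_char :: "nat \<Rightarrow> ('a, 'b) monoid_scheme \<Rightarrow> 'a set \<Rightarrow> ('a \<Rightarrow> complex) \<Rightarrow> bool" where
  "linear_char p G S \<chi> \<longleftrightarrow>
     (\<forall>x\<in>S. \<forall>y\<in>S. \<chi> (x \<otimes>\<^bsub>G\<^esub> y) = \<chi> x * \<chi> y) \<and> (\<forall>x\<in>S. \<chi> x ^ p = 1)"

lemma linear_char_mult:
  "linear_char p G S \<chi> \<Longrightarrow> x \<in> S \<Longrightarrow> y \<in> S \<Longrightarrow> \<chi> (x \<otimes>\<^bsub>G\<^esub> y) = \<chi> x * \<chi> y"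
  by (auto simp: linear_char_def)

lemma linear_char_power_eq_1: "linear_char p G S \<chi> \<Longrightarrow> x \<in> S \<Longrightarrow> \<chi> x ^ p = 1"
  by (auto simp: linear_char_def)

lemma linear_char_nonzero: "linear_char p G S \<chi> \<Longrightarrow> p > 0 \<Longrightarrow> x \<in> S \<Longrightarrow> \<chi> x \<noteq> 0"
  unfolding linear_char_def by (metis power_0_left zero_neq_one not_gr0)

context group
begin

lemma inv_cancel_left:
  assumes "g \<in> carrier G" "x \<in> carrier G"
  shows "inv g \<otimes> (g \<otimes> x) = x" "g \<otimes> (inv g \<otimes> x) = x"
  using assms by (simp_all add: m_assoc[symmetric])

lemma linear_char_one:
  assumes "linear_char p G S \<chi>" "p > 0" "subgroup S G"
  shows "\<chi> \<one> = 1"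
proof -
  have "\<one> \<in> S" by (rule subgroup.one_closed[OF assms(3)])
  then have "\<chi> \<one> = \<chi> \<one> * \<chi> \<one>" using linear_char_mult[OF assms(1), of \<one> \<one>] by simp
  then show ?thesis using linear_char_nonzero[OF assms(1,2) \<open>\<one> \<in> S\<close>] by simp
qed

lemma linear_char_pow:
  assumes "linear_char p G S \<chi>" "p > 0" "subgroup S G" "x \<in> S"
  shows "\<chi> (x [^] (n::nat)) = \<chi> x ^ n"
proof (induction n)
  case (Suc n)
  have "x [^] n \<in> S" using assms(3,4) by (metis subgroup_int_pow_closed int_pow_int)
  then show ?case using Suc linear_char_mult[OF assms(1) _ assms(4)] by simp
qed (simp add: linear_char_one[OF assms(1-3)])

lemma linear_char_conj:
  assumes "linear_char p G S \<chi>" "p > 0" "subgroup S G" "g \<in> S" "x \<in> S"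
  shows "\<chi> (g \<otimes> x \<otimes> inv g) = \<chi> x"
proof -
  have i: "inv g \<in> S" and gx: "g \<otimes> x \<in> S"
    using subgroup.m_inv_closed[OF assms(3,4)] subgroup.m_closed[OF assms(3-5)] by simp_all
  have "g \<in> carrier G" using subgroup.mem_carrier[OF assms(3,4)] .
  then have "\<chi> g * \<chi> (inv g) = 1"
    using linear_char_mult[OF assms(1,4) i] linear_char_one[OF assms(1-3)] by simp
  then show ?thesis
    using linear_char_mult[OF assms(1) gx i] linear_char_mult[OF assms(1,4,5)] by simp
qed

end

lemma linear_char_finprod:
  assumes A: "comm_group A" and \<chi>: "linear_char p A (carrier A) \<chi>" "p > 0"
    and f: "f \<in> X \<rightarrow> carrier A"
  shows "\<chi> (finprod A f X) = (\<Prod>x\<in>X. \<chi> (f x))"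
proof -
  interpret A: comm_group A by (rule A)
  have one: "\<chi> \<one>\<^bsub>A\<^esub> = 1" by (rule A.linear_char_one[OF \<chi> A.subgroup_self])
  show ?thesis
  proof (cases "finite X")
    case True
    then show ?thesis using f
    proof (induction X)
      case (insert x X)
      then show ?case using linear_char_mult[OF \<chi>(1)] A.finprod_closed[of f X] by (simp add: Pi_iff)
    qed (simp add: one)
  qed (simp add: one)
qed

section \<open>Conjugation, normalizers and the norm\<close>

context group
begin

lemma conj_mult:
  assumes "g \<in> carrier G" "x \<in> carrier G" "y \<in> carrier G"
  shows "g \<otimes> (x \<otimes> y) \<otimes> inv g = (g \<otimes> x \<otimes> inv g) \<otimes> (g \<otimes> y \<otimes> inv g)"
  using assms by (simp add: m_assoc inv_cancel_left)

lemma conj_conj: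
  assumes "g \<in> carrier G" "h \<in> carrier G" "x \<in> carrier G"
  shows "(g \<otimes> h) \<otimes> x \<otimes> inv (g \<otimes> h) = g \<otimes> (h \<otimes> x \<otimes> inv h) \<otimes> inv g"
  using assms by (simp add: m_assoc inv_mult_group)

lemma conj_pow:
  assumes "g \<in> carrier G" "x \<in> carrier G"
  shows "g \<otimes> x [^] (n::nat) \<otimes> inv g = (g \<otimes> x \<otimes> inv g) [^] n"
  by (induction n) (use assms in \<open>simp_all add: conj_mult\<close>)

lemma subgroup_conjugate:
  assumes H: "subgroup H G" and g: "g \<in> carrier G"
  shows "subgroup ((\<lambda>h. inv g \<otimes> h \<otimes> g) ` H) G"
proof (rule subgroupI)
  let ?K = "(\<lambda>h. inv g \<otimes> h \<otimes> g) ` H"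
  show "?K \<noteq> {}" using subgroup.one_closed[OF H] by auto
  show "?K \<subseteq> carrier G" using subgroup.mem_carrier[OF H] g by auto
  {
    fix a assume "a \<in> ?K"
    then obtain h where h: "h \<in> H" "a = inv g \<otimes> h \<otimes> g" by blast
    then have "inv a = inv g \<otimes> inv h \<otimes> g"
      using g subgroup.mem_carrier[OF H] by (simp add: inv_mult_group m_assoc)
    then show "inv a \<in> ?K" using h subgroup.m_inv_closed[OF H] by blast
  next
    fix a b assume "a \<in> ?K" "b \<in> ?K"
    then obtain h k where h: "h \<in> H" "a = inv g \<otimes> h \<otimes> g" and k: "k \<in> H" "b = inv g \<otimes> k \<otimes> g" by blast
    then have "a \<otimes> b = inv g \<otimes> (h \<otimes> k) \<otimes> g"
      using g subgroup.mem_carrier[OF H] by (simp add: m_assoc inv_cancel_left)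
    then show "a \<otimes> b \<in> ?K" using h k subgroup.m_closed[OF H] by blast
  }
qed

text \<open>For finite \<open>H\<close> the inclusion of a conjugate in \<open>H\<close> is already equality, since the two have the
  same size.\<close>

lemma normalizer_iff:
  assumes "finite H" "H \<subseteq> carrier G"
  shows "g \<in> normalizer G H \<longleftrightarrow> g \<in> carrier G \<and> (\<forall>h\<in>H. g \<otimes> h \<otimes> inv g \<in> H)"
proof (cases "g \<in> carrier G")
  case True
  let ?c = "\<lambda>h. g \<otimes> h \<otimes> inv g"
  have eq: "g <# H #> inv g = ?c ` H"
    by (auto simp: l_coset_def r_coset_def)
  have "inj_on ?c H"
  proof (rule inj_onI)
    fix x y assume "x \<in> H" "y \<in> H" "?c x = ?c y"
    then show "x = y" using assms(2) True by (metis inv_closed Units_eq Units_l_cancel m_closed right_cancel subsetD)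
  qed
  then have "?c ` H = H \<longleftrightarrow> ?c ` H \<subseteq> H"
    using assms(1) card_subset_eq[of H "?c ` H"] card_image[of ?c H] by auto
  then show ?thesis using True assms(2) eq by (auto simp: normalizer_def stabilizer_def)
qed (simp add: normalizer_def stabilizer_def)

lemma normalizer_conj_iff:
  assumes "subgroup H G" "finite H" "t \<in> normalizer G H" "w \<in> carrier G"
  shows "t \<otimes> w \<otimes> inv t \<in> H \<longleftrightarrow> w \<in> H"
proof
  have sub: "subgroup (normalizer G H) G" using normalizer_imp_subgroup subgroup.subset[OF assms(1)] .
  have iff: "\<And>g. g \<in> normalizer G H \<longleftrightarrow> g \<in> carrier G \<and> (\<forall>h\<in>H. g \<otimes> h \<otimes> inv g \<in> H)"
    using normalizer_iff[OF assms(2) subgroup.subset[OF assms(1)]] .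
  have t: "t \<in> carrier G" using assms(3) iff by blast
  have "inv t \<in> normalizer G H" using sub assms(3) by (rule subgroup.m_inv_closed)
  moreover assume "t \<otimes> w \<otimes> inv t \<in> H"
  ultimately have "inv t \<otimes> (t \<otimes> w \<otimes> inv t) \<otimes> inv (inv t) \<in> H" using iff by blast
  then show "w \<in> H" using t assms(4) by (simp add: m_assoc inv_cancel_left)
next
  assume "w \<in> H"
  then show "t \<otimes> w \<otimes> inv t \<in> H"
    using assms(3) normalizer_iff[OF assms(2) subgroup.subset[OF assms(1)]] by blast
qed

lemma subset_normalizer:
  assumes "finite (carrier G)" "subgroup P G"
  shows "P \<subseteq> normalizer G P"
proof
  fix g assume g: "g \<in> P"
  show "g \<in> normalizer G P"
    using normalizer_iff[OF finite_subset[OF subgroup.subset[OF assms(2)] assms(1)] subgroup.subset[OF assms(2)]]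
      g subgroup.m_closed[OF assms(2)] subgroup.m_inv_closed[OF assms(2)] subgroup.mem_carrier[OF assms(2)]
    by simp
qed

lemma subgroup_nat_powers:
  assumes "finite (carrier G)" "x \<in> carrier G"
  shows "subgroup (range (\<lambda>k::nat. x [^] k)) G"
proof (rule subgroupI)
  fix a assume "a \<in> range (\<lambda>k::nat. x [^] k)"
  then obtain k :: nat where a: "a = x [^] k" by auto
  have o: "order G > 0" using assms by (simp add: order_gt_0_iff_finite)
  have "x [^] (k * (order G - 1)) \<otimes> x [^] k = x [^] (k * (order G - 1) + k)"
    using assms by (simp add: nat_pow_mult)
  also have "k * (order G - 1) + k = order G * k" using o by (cases "order G") auto
  also have "x [^] (order G * k) = \<one>"
    using pow_order_eq_1[OF assms(2)] assms(2) by (simp add: nat_pow_pow[symmetric])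
  finally have "inv a = x [^] (k * (order G - 1))"
    using a assms(2) by (simp add: inv_equality)
  then show "inv a \<in> range (\<lambda>k::nat. x [^] k)" by blast
next
  fix a b assume "a \<in> range (\<lambda>k::nat. x [^] k)" "b \<in> range (\<lambda>k::nat. x [^] k)"
  then show "a \<otimes> b \<in> range (\<lambda>k::nat. x [^] k)" using assms(2) by (auto simp: nat_pow_mult)
qed (use assms in auto)

lemma group_norm_conj:
  assumes "finite (carrier G)" "z \<in> group_norm G" "subgroup H G" "h \<in> H"
  shows "z \<otimes> h \<otimes> inv z \<in> H"
proof -
  have "z \<in> normalizer G H" using assms(2,3) by (simp add: group_norm_def)
  then show ?thesis
    using assms(4) normalizer_iff[OF finite_subset[OF _ assms(1)]] subgroup.subset[OF assms(3)] by simp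
qed

text \<open>An element of the norm normalizes every cyclic subgroup, so it conjugates each element to one of
  its powers.\<close>

lemma group_norm_conj_pow:
  assumes "finite (carrier G)" "z \<in> group_norm G" "v \<in> carrier G"
  obtains k :: nat where "z \<otimes> v \<otimes> inv z = v [^] k"
proof -
  have "v \<in> range (\<lambda>k::nat. v [^] k)" using assms(3) by (metis nat_pow_eone rangeI)
  then have "z \<otimes> v \<otimes> inv z \<in> range (\<lambda>k::nat. v [^] k)"
    using group_norm_conj[OF assms(1,2) subgroup_nat_powers[OF assms(1,3)]] by blast
  then show ?thesis using that by auto
qed

lemma subgroup_group_norm: "finite (carrier G) \<Longrightarrow> subgroup (group_norm G) G"
  unfolding group_norm_def
  by (rule subgroups_Inter) (auto intro!: normalizer_imp_subgroup intro: subgroup_self dest: subgroup.subset)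

text \<open>Conjugation permutes the subgroups, hence their normalizers.\<close>

lemma group_norm_normalized:
  assumes fin: "finite (carrier G)" and z: "z \<in> group_norm G" and g: "g \<in> carrier G"
  shows "g \<otimes> z \<otimes> inv g \<in> group_norm G"
  unfolding group_norm_def
proof (rule INT_I)
  fix H assume "H \<in> {H. subgroup H G}"
  then have H: "subgroup H G" by simp
  have zc: "z \<in> carrier G" using z subgroup.mem_carrier[OF subgroup_group_norm[OF fin]] by blast
  let ?K = "(\<lambda>h. inv g \<otimes> h \<otimes> g) ` H"
  have K: "subgroup ?K G" by (rule subgroup_conjugate[OF H g])
  have "g \<otimes> z \<otimes> inv g \<otimes> h \<otimes> inv (g \<otimes> z \<otimes> inv g) \<in> H" if h: "h \<in> H" for h
  proof -
    have hc: "h \<in> carrier G" using subgroup.mem_carrier[OF H] h .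
    have "z \<otimes> (inv g \<otimes> h \<otimes> g) \<otimes> inv z \<in> ?K" using group_norm_conj[OF fin z K] h by blast
    then obtain k where k: "k \<in> H" "z \<otimes> (inv g \<otimes> h \<otimes> g) \<otimes> inv z = inv g \<otimes> k \<otimes> g" by blast
    have kc: "k \<in> carrier G" using subgroup.mem_carrier[OF H] k by blast
    have "g \<otimes> z \<otimes> inv g \<otimes> h \<otimes> inv (g \<otimes> z \<otimes> inv g) = g \<otimes> (z \<otimes> (inv g \<otimes> h \<otimes> g) \<otimes> inv z) \<otimes> inv g"
      using g zc hc by (simp add: m_assoc inv_mult_group)
    also have "\<dots> = k" using k(2) g kc by (simp add: m_assoc inv_cancel_left)
    finally show ?thesis using k(1) by simp
  qed
  then show "g \<otimes> z \<otimes> inv g \<in> normalizer G H"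
    using normalizer_iff[OF finite_subset[OF subgroup.subset[OF H] fin] subgroup.subset[OF H]] g zc by simp
qed

text \<open>The last iterated \<open>p\<close>-th power of \<open>x\<close> outside \<open>D\<close>.\<close>

lemma first_p_power_in:
  assumes "x \<in> carrier G" "x \<notin> D" "x [^] (p ^ n :: nat) \<in> D"
  obtains m where "x [^] (p ^ m :: nat) \<notin> D" "(x [^] (p ^ m :: nat)) [^] p \<in> D"
proof -
  define l where "l = (LEAST l. x [^] (p ^ l :: nat) \<in> D)"
  have l: "x [^] (p ^ l :: nat) \<in> D" unfolding l_def using assms(3) by (rule LeastI)
  then have "l \<noteq> 0" using assms by (cases l) auto
  then obtain m where m: "l = Suc m" by (cases l) auto
  have "x [^] (p ^ m :: nat) \<notin> D" using m not_less_Least[of m "\<lambda>l. x [^] (p ^ l :: nat) \<in> D"] unfolding l_def by auto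
  moreover have "(x [^] (p ^ m :: nat)) [^] p \<in> D"
    using l m assms(1) by (simp add: nat_pow_pow mult.commute)
  ultimately show thesis using that by blast
qed

lemma mem_subgroup_of_coprime_pow:
  assumes "subgroup D G" "a \<in> carrier G" "a [^] (m::nat) \<in> D" "a [^] (n::nat) \<in> D" "coprime m n"
  shows "a \<in> D"
proof -
  obtain i j where ij: "i * int m + j * int n = 1"
    using bezout_int[of "int m" "int n"] assms(5) by auto
  have "(a [^] m) [^] i \<otimes> (a [^] n) [^] j = a [^] (i * int m + j * int n)"
    using assms(2) by (simp add: int_pow_pow int_pow_int[symmetric] int_pow_mult mult.commute)
  moreover have "(a [^] m) [^] i \<otimes> (a [^] n) [^] j \<in> D"
    using assms subgroup_int_pow_closed subgroup.m_closed by metis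
  ultimately show ?thesis using ij assms(2) by simp
qed

end

section \<open>Subgroups no larger than the norm\<close>

context group
begin

text \<open>The element \<open>z\<close> acts on the cyclic subgroup of \<open>v\<close> by an automorphism of \<open>p\<close>-power order, and such
  an automorphism acts trivially on quotients of order \<open>p\<close>.\<close>

lemma norm_conj_char:
  assumes p: "Factorial_Ring.prime p" and ord: "order G = p ^ n" and z: "z \<in> group_norm G"
    and D: "subgroup D G" and \<chi>: "linear_char p G D \<chi>" and v: "v \<in> D"
  shows "\<chi> (z \<otimes> v \<otimes> inv z) = \<chi> v"
proof -
  have p0: "p > 0" using p by (rule prime_gt_0_nat)
  have fin: "finite (carrier G)" using ord p0 order_gt_0_iff_finite by simp
  have zc: "z \<in> carrier G" using z subgroup.mem_carrier[OF subgroup_group_norm[OF fin]] by blast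
  have vc: "v \<in> carrier G" using subgroup.mem_carrier[OF D v] .
  obtain k :: nat where k: "z \<otimes> v \<otimes> inv z = v [^] k"
    using group_norm_conj_pow[OF fin z vc] .
  have it: "z [^] i \<otimes> v \<otimes> inv (z [^] i) = v [^] (k ^ i)" for i :: nat
  proof (induction i)
    case (Suc i)
    have "z [^] Suc i \<otimes> v \<otimes> inv (z [^] Suc i) = z [^] i \<otimes> (z \<otimes> v \<otimes> inv z) \<otimes> inv (z [^] i)"
      using conj_conj[of "z [^] i" z v] zc vc by simp
    also have "\<dots> = (v [^] (k ^ i)) [^] k"
      using zc vc k Suc conj_pow[of "z [^] i" v k] by simp
    finally show ?case using vc by (simp add: nat_pow_pow mult.commute)
  qed (use vc in simp)
  \<comment> \<open>Since \<open>z\<close> has \<open>p\<close>-power order, \<open>v = v [^] (k ^ (p ^ n))\<close>, and Fermat turns that exponent into \<open>k\<close>.\<close>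
  have "v = v [^] (k ^ (p ^ n))"
    using it[of "p ^ n"] pow_order_eq_1[OF zc] ord vc by simp
  then have "\<chi> v = \<chi> v ^ (k ^ (p ^ n))" using linear_char_pow[OF \<chi> p0 D v] by metis
  also have "\<dots> = \<chi> v ^ k"
    by (rule root_of_unity_power_fermat[OF p linear_char_power_eq_1[OF \<chi> v]])
  finally show ?thesis using k linear_char_pow[OF \<chi> p0 D v, of k] by simp
qed

text \<open>Supplement for \<open>p = 2\<close> to the computation with \<open>c [^] i \<otimes> v\<close> in the next lemma. For odd
  \<open>p\<close> the character need not be invariant: in the nonabelian group of order \<open>p ^ 3\<close> and exponent
  \<open>p ^ 2\<close> the norm is elementary abelian of order \<open>p ^ 2\<close>, and a character that is nontrivial on the
  centre is not invariant.\<close>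

lemma norm_char_invariant_2:
  assumes fin: "finite (carrier G)" and D: "subgroup D G" and t: "t \<in> carrier G" "t \<notin> D"
    and sq: "t \<otimes> t \<in> D" and nt: "\<And>w. w \<in> D \<Longrightarrow> t \<otimes> w \<otimes> inv t \<in> D"
    and v: "v \<in> D" "v \<in> group_norm G" and \<chi>: "linear_char 2 G D \<chi>"
  shows "\<chi> (t \<otimes> v \<otimes> inv t) = \<chi> v"
proof -
  note mult = linear_char_mult[OF \<chi>]
  have pm: "\<chi> x = 1 \<or> \<chi> x = - 1" if "x \<in> D" for x
    using linear_char_power_eq_1[OF \<chi> that] by (simp add: power2_eq_1_iff)
  have vc: "v \<in> carrier G" using subgroup.mem_carrier[OF D v(1)] .
  have iv: "inv v \<in> D" using subgroup.m_inv_closed[OF D v(1)] .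
  define w where "w = t \<otimes> v \<otimes> inv t"
  have w: "w \<in> D" "w \<in> carrier G" unfolding w_def using nt v(1) t vc by auto
  have chinv: "\<chi> (inv v) = \<chi> v"
  proof -
    have "\<chi> v * \<chi> (inv v) = 1"
      using mult[OF v(1) iv] linear_char_one[OF \<chi> _ D] vc by simp
    then show ?thesis using pm[OF v(1)] by (auto simp: minus_equation_iff)
  qed
  \<comment> \<open>The commutator of \<open>s\<close> and \<open>v\<close> is \<open>w \<otimes> inv v\<close> and also a power of \<open>s\<close>; being in \<open>D\<close> it is
    a power of \<open>s \<otimes> s\<close>, so \<open>\<chi>\<close> sends it to \<open>1\<close> or to \<open>\<chi> (s \<otimes> s)\<close>.\<close>
  have comm: "\<chi> (w \<otimes> inv v) = 1 \<or> \<chi> (w \<otimes> inv v) = \<chi> (s \<otimes> s)"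
    if s: "s \<in> carrier G" "s \<notin> D" "s \<otimes> s \<in> D" and sw: "s \<otimes> v \<otimes> inv s = w" for s
  proof -
    obtain k :: nat where k: "v \<otimes> s \<otimes> inv v = s [^] k"
      using group_norm_conj_pow[OF fin v(2) s(1)] .
    have sp: "(s \<otimes> s) [^] (i::nat) \<in> D" for i
      using subgroup_int_pow_closed[OF D s(3), of "int i"] by (simp add: int_pow_int)
    have s2: "s [^] (2 * i) = (s \<otimes> s) [^] i" for i :: nat
      using nat_pow_pow[OF s(1), of 2 i] s(1) by (simp add: numeral_2_eq_2)
    have "(w \<otimes> inv v) \<otimes> s [^] k = s \<otimes> v \<otimes> inv s \<otimes> inv v \<otimes> (v \<otimes> s \<otimes> inv v)"
      using k sw by simp
    also have "\<dots> = s" using s(1) vc by (simp add: m_assoc inv_cancel_left)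
    finally have e: "(w \<otimes> inv v) \<otimes> s [^] k = s" .
    have wv: "w \<otimes> inv v \<in> D" using subgroup.m_closed[OF D w(1) iv] .
    have "odd k"
    proof
      assume "even k"
      then obtain i where "k = 2 * i" by (elim evenE)
      then have "s \<in> D" using e s2 sp subgroup.m_closed[OF D wv] by metis
      then show False using s(2) by simp
    qed
    then obtain i where i: "k = 2 * i + 1" by (elim oddE)
    have "(w \<otimes> inv v) \<otimes> (s \<otimes> s) [^] i \<otimes> s = s"
      using e i s(1) s2[of i] w(2) vc by (simp add: m_assoc)
    then have "(w \<otimes> inv v) \<otimes> (s \<otimes> s) [^] i = \<one>"
      using s(1) w(2) vc by (metis m_closed inv_closed nat_pow_closed l_one one_closed right_cancel)
    then have "\<chi> (w \<otimes> inv v) * \<chi> (s \<otimes> s) ^ i = 1"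
      using mult[OF wv sp[of i]] linear_char_one[OF \<chi> _ D] linear_char_pow[OF \<chi> _ D s(3), of i]
      by simp
    then show ?thesis using pm[OF s(3)] pm[OF wv] by (cases "even i") auto
  qed
  \<comment> \<open>\<open>t \<otimes> v\<close> has the same commutator with \<open>v\<close> as \<open>t\<close>, but if \<open>\<chi>\<close> is \<open>-1\<close> on that commutator,
    then \<open>\<chi>\<close> takes different values on the two squares.\<close>
  define s where "s = t \<otimes> v"
  have sc: "s \<in> carrier G" using t vc by (simp add: s_def)
  have sD: "s \<otimes> s = w \<otimes> (t \<otimes> t) \<otimes> v"
    unfolding s_def w_def using vc t by (simp add: m_assoc inv_cancel_left)
  have s1: "s \<otimes> s \<in> D" unfolding sD using subgroup.m_closed[OF D] v(1) w(1) sq by blast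
  have s2: "s \<notin> D"
  proof
    assume "s \<in> D"
    then have "s \<otimes> inv v \<in> D" using subgroup.m_closed[OF D _ iv] by blast
    then show False using t vc unfolding s_def by (simp add: m_assoc)
  qed
  have s3: "s \<otimes> v \<otimes> inv s = w"
    unfolding s_def w_def using vc t by (simp add: m_assoc inv_mult_group inv_cancel_left)
  have chs: "\<chi> (s \<otimes> s) = \<chi> w * \<chi> (t \<otimes> t) * \<chi> v"
    unfolding sD using mult v(1) w(1) sq subgroup.m_closed[OF D w(1) sq] by simp
  have chw: "\<chi> (w \<otimes> inv v) = \<chi> w * \<chi> v" using mult[OF w(1) iv] chinv by simp
  have "\<chi> w * \<chi> v = 1"
    using comm[OF sc s2 s1 s3] comm[OF t sq w_def[symmetric]] chs chw pm[OF sq] by auto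
  then show ?thesis using pm[OF v(1)] pm[OF w(1)] unfolding w_def by auto
qed

text \<open>Since \<open>v\<close> normalizes the cyclic subgroup of \<open>t\<close>, the commutator \<open>c\<close> of \<open>t\<close> and \<open>v\<close> is a power of
  \<open>t\<close>. Hence \<open>c\<close> commutes with \<open>t\<close>, and conjugation by \<open>t [^] i\<close> sends \<open>v\<close> to \<open>c [^] i \<otimes> v\<close>.
  The values of the character form a geometric progression with ratio a \<open>p\<close>-th root of unity, whose
  product is \<open>1\<close> for odd \<open>p\<close>.\<close>

lemma prod_conj_char_of_norm:
  assumes p: "Factorial_Ring.prime p" and fin: "finite (carrier G)" and D: "subgroup D G"
    and t: "t \<in> carrier G" "t \<notin> D" and tp: "t [^] p \<in> D"
    and nt: "\<And>w. w \<in> D \<Longrightarrow> t \<otimes> w \<otimes> inv t \<in> D"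
    and v: "v \<in> D" "v \<in> group_norm G" and \<chi>: "linear_char p G D \<chi>"
  shows "(\<Prod>i<p. \<chi> (t [^] i \<otimes> v \<otimes> inv (t [^] i))) = 1"
proof (cases "p = 2")
  case True
  have sq: "t \<otimes> t \<in> D" using tp t(1) True by (simp add: numeral_2_eq_2)
  have vc: "v \<in> carrier G" using subgroup.mem_carrier[OF D v(1)] .
  have "(\<Prod>i<p. \<chi> (t [^] i \<otimes> v \<otimes> inv (t [^] i))) = \<chi> v * \<chi> (t \<otimes> v \<otimes> inv t)"
    using True t(1) vc by (simp add: numeral_2_eq_2)
  also have "\<dots> = \<chi> v ^ p"
    using norm_char_invariant_2[OF fin D t sq nt v] \<chi> True by (simp add: power2_eq_square)
  finally show ?thesis using linear_char_power_eq_1[OF \<chi> v(1)] by simp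
next
  case False
  have p0: "p > 0" using p by (rule prime_gt_0_nat)
  have vc: "v \<in> carrier G" using subgroup.mem_carrier[OF D v(1)] .
  define c where "c = t \<otimes> v \<otimes> inv t \<otimes> inv v"
  have cD: "c \<in> D"
    unfolding c_def using subgroup.m_closed[OF D nt[OF v(1)] subgroup.m_inv_closed[OF D v(1)]] .
  have cc: "c \<in> carrier G" using subgroup.mem_carrier[OF D cD] .
  obtain k :: nat where k: "v \<otimes> t \<otimes> inv v = t [^] k"
    using group_norm_conj_pow[OF fin v(2) t(1)] .
  have c: "c = t \<otimes> inv (t [^] k)"
    unfolding c_def k[symmetric] using t vc by (simp add: m_assoc inv_mult_group)
  \<comment> \<open>By \<open>c\<close> above, \<open>c\<close> is a power of \<open>t\<close>; hence it commutes with \<open>t\<close>.\<close>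
  have ct: "t [^] i \<otimes> c \<otimes> inv (t [^] i) = c" for i :: nat
  proof -
    have "t [^] i \<otimes> c = c \<otimes> t [^] i"
    proof -
      have comm: "t [^] i \<otimes> inv (t [^] k) = inv (t [^] k) \<otimes> t [^] i"
        using t by (simp add: inv_solve_left inv_solve_right m_assoc[symmetric] nat_pow_mult add.commute)
      have "t [^] i \<otimes> c = t \<otimes> (t [^] i \<otimes> inv (t [^] k))"
        unfolding c using t by (simp add: m_assoc[symmetric] nat_pow_Suc2[symmetric])
      then show ?thesis unfolding comm c using t by (simp add: m_assoc)
    qed
    then show ?thesis using t cc by (simp add: m_assoc)
  qed
  have it: "t [^] i \<otimes> v \<otimes> inv (t [^] i) = c [^] i \<otimes> v" for i :: nat
  proof (induction i)
    case (Suc i)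
    have "t [^] Suc i \<otimes> v \<otimes> inv (t [^] Suc i) = t [^] i \<otimes> (t \<otimes> v \<otimes> inv t) \<otimes> inv (t [^] i)"
      using conj_conj[of "t [^] i" t v] t vc by simp
    also have "t \<otimes> v \<otimes> inv t = c \<otimes> v" unfolding c_def using t vc by (simp add: m_assoc)
    also have "t [^] i \<otimes> (c \<otimes> v) \<otimes> inv (t [^] i) = c \<otimes> (c [^] i \<otimes> v)"
      using conj_mult[of "t [^] i" c v] t cc vc ct Suc by simp
    finally show ?case using cc vc nat_pow_Suc2[OF cc, of i] by (simp add: m_assoc)
  qed (use vc in simp)
  have "(\<Prod>i<p. \<chi> (t [^] i \<otimes> v \<otimes> inv (t [^] i))) = (\<Prod>i<p. \<chi> c ^ i * \<chi> v)"
  proof (rule prod.cong)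
    fix i :: nat
    have "c [^] i \<in> D" using subgroup_int_pow_closed[OF D cD, of "int i"] by (simp add: int_pow_int)
    then show "\<chi> (t [^] i \<otimes> v \<otimes> inv (t [^] i)) = \<chi> c ^ i * \<chi> v"
      using it linear_char_mult[OF \<chi> _ v(1)] linear_char_pow[OF \<chi> p0 D cD] by simp
  qed simp
  also have "\<dots> = (\<Prod>i<p. \<chi> c ^ i) * \<chi> v ^ p" by (simp add: prod.distrib)
  finally show ?thesis
    using prod_powers_prime_period[OF p linear_char_power_eq_1[OF \<chi> cD] False]
      linear_char_power_eq_1[OF \<chi> v(1)] by simp
qed

text \<open>This is the only place where the size of the norm enters. If the norm is not contained in \<open>D\<close>,
  then \<open>t\<close> is taken in the norm, and each factor equals \<open>\<chi> v\<close>. Otherwise the size condition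
  forces \<open>D\<close> to be the norm itself; then \<open>D\<close> is normal, every \<open>v \<in> D\<close> is in the norm, and any
  \<open>t\<close> outside \<open>D\<close> with \<open>p\<close>-th power in \<open>D\<close> will do.\<close>

lemma normalizing_element_cancelling_chars:
  assumes p: "Factorial_Ring.prime p" and ord: "order G = p ^ n" and D: "subgroup D G"
    and ne: "D \<noteq> carrier G" and le: "card D \<le> card (group_norm G)"
  obtains t where "t \<in> carrier G" "t \<notin> D" "t [^] p \<in> D" "t \<in> normalizer G D"
    "\<And>\<chi> v. linear_char p G D \<chi> \<Longrightarrow> v \<in> D \<Longrightarrow>
       (\<Prod>i<p. \<chi> (t [^] i \<otimes> v \<otimes> inv (t [^] i))) = 1"
proof -
  have p0: "p > 0" using p by (rule prime_gt_0_nat)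
  have fin: "finite (carrier G)" using ord p0 order_gt_0_iff_finite by simp
  have Zs: "subgroup (group_norm G) G" by (rule subgroup_group_norm[OF fin])
  have finZ: "finite (group_norm G)" using finite_subset[OF subgroup.subset[OF Zs] fin] .
  have Dc: "D \<subseteq> carrier G" by (rule subgroup.subset[OF D])
  have finD: "finite D" using finite_subset[OF Dc fin] .
  have inD: "x [^] (p ^ n) \<in> D" if "x \<in> carrier G" for x
    using pow_order_eq_1[OF that] ord subgroup.one_closed[OF D] by simp
  show thesis
  proof (cases "group_norm G \<subseteq> D")
    case False
    then obtain z where z: "z \<in> group_norm G" "z \<notin> D" by blast
    have zc: "z \<in> carrier G" using subgroup.mem_carrier[OF Zs z(1)] .
    obtain m where m: "z [^] (p ^ m) \<notin> D" "(z [^] (p ^ m)) [^] p \<in> D"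
      using first_p_power_in[OF zc z(2) inD[OF zc]] .
    define t where "t = z [^] (p ^ m)"
    have tc: "t \<in> carrier G" using zc by (simp add: t_def)
    have tZ: "t [^] i \<in> group_norm G" for i :: nat
      unfolding t_def nat_pow_pow[OF zc]
      using subgroup_int_pow_closed[OF Zs z(1)] by (metis int_pow_int)
    have tZ1: "t \<in> group_norm G" using tZ[of 1] tc by simp
    show thesis
    proof (rule that[of t])
      show "t \<in> normalizer G D" using tZ1 D by (simp add: group_norm_def)
      fix \<chi> v assume \<chi>: "linear_char p G D \<chi>" and v: "v \<in> D"
      have "(\<Prod>i<p. \<chi> (t [^] i \<otimes> v \<otimes> inv (t [^] i))) = (\<Prod>i<p. \<chi> v)"
        using norm_conj_char[OF p ord tZ D \<chi> v] by simp
      then show "(\<Prod>i<p. \<chi> (t [^] i \<otimes> v \<otimes> inv (t [^] i))) = 1"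
        using linear_char_power_eq_1[OF \<chi> v] by simp
    qed (use tc m in \<open>simp_all add: t_def\<close>)
  next
    case True
    then have eq: "D = group_norm G" using card_seteq[OF finD True le] by simp
    obtain g where g: "g \<in> carrier G" "g \<notin> D" using ne Dc by blast
    obtain m where m: "g [^] (p ^ m) \<notin> D" "(g [^] (p ^ m)) [^] p \<in> D"
      using first_p_power_in[OF g inD[OF g(1)]] .
    define t where "t = g [^] (p ^ m)"
    have tc: "t \<in> carrier G" using g by (simp add: t_def)
    have nt: "t \<otimes> w \<otimes> inv t \<in> D" if "w \<in> D" for w
      using group_norm_normalized[OF fin _ tc] that eq by simp
    show thesis
    proof (rule that[of t])
      show "t \<in> normalizer G D" using normalizer_iff[OF finD Dc] tc nt by simp
      fix \<chi> v assume \<chi>: "linear_char p G D \<chi>" and v: "v \<in> D"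
      show "(\<Prod>i<p. \<chi> (t [^] i \<otimes> v \<otimes> inv (t [^] i))) = 1"
        by (rule prod_conj_char_of_norm[OF p fin D tc _ _ nt v _ \<chi>])
          (use m v eq in \<open>simp_all add: t_def\<close>)
    qed (use tc m in \<open>simp_all add: t_def\<close>)
  qed
qed

end

section \<open>The transfer homomorphism\<close>

context group
begin

lemma finite_rcosets:
  assumes "finite (carrier G)" "subgroup H G"
  shows "finite (rcosets H)"
  using assms(1) subgroup.rcosets_carrier[OF assms(2) is_group]
  by (intro finite_subset[of "rcosets H" "Pow (carrier G)"]) auto

lemma rcosets_translate:
  assumes "subgroup H G" "C \<in> rcosets H" "g \<in> carrier G"
  shows "C #> g \<in> rcosets H"
  using assms subgroup.subset[OF assms(1)] coset_mult_assoc unfolding RCOSETS_def by fastforce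

lemma rcosets_translate_assoc:
  assumes "subgroup H G" "C \<in> rcosets H" "g \<in> carrier G" "k \<in> carrier G"
  shows "(C #> g) #> k = C #> (g \<otimes> k)"
  by (rule coset_mult_assoc[OF subgroup.rcosets_carrier[OF assms(1) is_group assms(2)] assms(3,4)])

lemma mem_rcoset_iff:
  assumes "subgroup H G" "x \<in> carrier G" "y \<in> carrier G"
  shows "H #> x = H #> y \<longleftrightarrow> x \<otimes> inv y \<in> H"
proof
  assume "H #> x = H #> y"
  then obtain h where "h \<in> H" "x = h \<otimes> y" using rcos_self[OF assms(2,1)] by (auto simp: r_coset_def)
  then show "x \<otimes> inv y \<in> H" using assms subgroup.mem_carrier[OF assms(1)] by (simp add: m_assoc)
next
  assume h: "x \<otimes> inv y \<in> H"
  have "x = (x \<otimes> inv y) \<otimes> y" using assms by (simp add: m_assoc)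
  then have "x \<in> H #> y" using h unfolding r_coset_def by blast
  then show "H #> x = H #> y" using repr_independence[OF _ assms(3,1)] by simp
qed

definition coset_rep :: "'a set \<Rightarrow> 'a" where
  "coset_rep C = (SOME x. x \<in> C)"

lemma coset_rep_mem:
  assumes "subgroup H G" "C \<in> rcosets H"
  shows "coset_rep C \<in> C" "coset_rep C \<in> carrier G" "H #> coset_rep C = C"
proof -
  obtain x where x: "x \<in> carrier G" "C = H #> x" using assms(2) unfolding RCOSETS_def by auto
  show 1: "coset_rep C \<in> C"
    unfolding coset_rep_def using rcos_self[OF x(1) assms(1)] x(2) by (metis someI)
  then show "coset_rep C \<in> carrier G" using x subgroup.subset[OF assms(1)] r_coset_subset_G by blast
  show "H #> coset_rep C = C" using repr_independence[OF _ x(1) assms(1)] 1 x(2) by metis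
qed

text \<open>A coset \<open>C\<close> with representative \<open>x\<close> is moved by \<open>g\<close> to a coset with representative \<open>y\<close>; the factor
  is the element \<open>x \<otimes> g \<otimes> inv y\<close> of the subgroup that measures the discrepancy.\<close>

definition transfer_factor :: "'a set \<Rightarrow> 'a \<Rightarrow> 'a" where
  "transfer_factor C g = coset_rep C \<otimes> g \<otimes> inv (coset_rep (C #> g))"

lemma transfer_factor_mem:
  assumes H: "subgroup H G" and C: "C \<in> rcosets H" and g: "g \<in> carrier G"
  shows "transfer_factor C g \<in> H"
proof -
  note Cg = rcosets_translate[OF H C g]
  have "H #> (coset_rep C \<otimes> g) = H #> coset_rep (C #> g)"
    using coset_rep_mem[OF H C] coset_rep_mem[OF H Cg] g
      coset_mult_assoc[OF subgroup.subset[OF H]] by metis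
  then show ?thesis
    using mem_rcoset_iff[OF H] coset_rep_mem(2)[OF H C] coset_rep_mem(2)[OF H Cg] g
    by (simp add: transfer_factor_def)
qed

lemma transfer_factor_mult:
  assumes H: "subgroup H G" and C: "C \<in> rcosets H" and g: "g \<in> carrier G" and k: "k \<in> carrier G"
  shows "transfer_factor C (g \<otimes> k) = transfer_factor C g \<otimes> transfer_factor (C #> g) k"
  using coset_rep_mem(2)[OF H C] coset_rep_mem(2)[OF H rcosets_translate[OF H C g]]
    coset_rep_mem(2)[OF H rcosets_translate[OF H rcosets_translate[OF H C g] k]] g k
  by (simp add: transfer_factor_def rcosets_translate_assoc[OF H C g k] m_assoc inv_cancel_left)

lemma transfer_factor_one:
  assumes "subgroup H G" "C \<in> rcosets H"
  shows "transfer_factor C \<one> = \<one>"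
  using coset_rep_mem(2)[OF assms] subgroup.rcosets_carrier[OF assms(1) is_group assms(2)]
  by (simp add: transfer_factor_def coset_mult_one)

definition transfer :: "'a set \<Rightarrow> ('c, 'd) monoid_scheme \<Rightarrow> ('a \<Rightarrow> 'c) \<Rightarrow> 'a \<Rightarrow> 'c" where
  "transfer H A \<theta> g = (\<Otimes>\<^bsub>A\<^esub>C\<in>rcosets H. \<theta> (transfer_factor C g))"

text \<open>The factors satisfy a cocycle identity, and translation by \<open>g\<close> permutes the cosets over which the
  product is taken.\<close>

lemma transfer_hom:
  assumes H: "subgroup H G" and A: "comm_group A" and \<theta>: "\<theta> \<in> hom (G\<lparr>carrier := H\<rparr>) A"
  shows "transfer H A \<theta> \<in> hom G A"
proof (rule homI)
  interpret A: comm_group A by (rule A)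
  have \<theta>c: "\<theta> x \<in> carrier A" if "x \<in> H" for x using \<theta> that by (auto simp: hom_def)
  have \<theta>m: "\<theta> (x \<otimes> y) = \<theta> x \<otimes>\<^bsub>A\<^esub> \<theta> y" if "x \<in> H" "y \<in> H" for x y using \<theta> that by (auto simp: hom_def)
  note mem = transfer_factor_mem[OF H]
  show "transfer H A \<theta> g \<in> carrier A" if "g \<in> carrier G" for g
    unfolding transfer_def by (rule A.finprod_closed) (use \<theta>c mem that in auto)
  fix g k assume g: "g \<in> carrier G" and k: "k \<in> carrier G"
  note tr = rcosets_translate[OF H]
  note trm = rcosets_translate_assoc[OF H]
  have undo: "(C #> g) #> inv g = C" "(C #> inv g) #> g = C" if C: "C \<in> rcosets H" for C
    using g trm[OF C g inv_closed[OF g]] trm[OF C inv_closed[OF g] g]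
      subgroup.rcosets_carrier[OF H is_group C] by (simp_all add: coset_mult_one)
  have im: "(\<lambda>C. C #> g) ` (rcosets H) = rcosets H"
  proof (intro equalityI subsetI)
    fix C assume C: "C \<in> rcosets H"
    have "C = (C #> inv g) #> g" using undo(2)[OF C] by simp
    then show "C \<in> (\<lambda>C. C #> g) ` (rcosets H)" using tr[OF C inv_closed[OF g]] by (rule image_eqI)
  qed (use tr[OF _ g] in blast)
  have inj: "inj_on (\<lambda>C. C #> g) (rcosets H)" by (rule inj_onI) (metis undo(1))
  have "transfer H A \<theta> (g \<otimes> k)
      = (\<Otimes>\<^bsub>A\<^esub>C\<in>rcosets H. \<theta> (transfer_factor C g) \<otimes>\<^bsub>A\<^esub> \<theta> (transfer_factor (C #> g) k))"
    unfolding transfer_def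
    by (rule A.finprod_cong')
      (use mem tr g k \<theta>c \<theta>m transfer_factor_mult[OF H _ g k] in auto)
  also have "\<dots> = transfer H A \<theta> g \<otimes>\<^bsub>A\<^esub> (\<Otimes>\<^bsub>A\<^esub>C\<in>rcosets H. \<theta> (transfer_factor (C #> g) k))"
    unfolding transfer_def by (rule A.finprod_multf) (use mem tr g k \<theta>c in auto)
  also have "(\<Otimes>\<^bsub>A\<^esub>C\<in>rcosets H. \<theta> (transfer_factor (C #> g) k)) = transfer H A \<theta> k"
    unfolding transfer_def
    using A.finprod_reindex[of "\<lambda>C. \<theta> (transfer_factor C k)" "\<lambda>C. C #> g" "rcosets H"] im inj mem k \<theta>c
    by auto
  finally show "transfer H A \<theta> (g \<otimes> k) = transfer H A \<theta> g \<otimes>\<^bsub>A\<^esub> transfer H A \<theta> k" .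
qed

end

section \<open>Evaluating a character of the transfer\<close>

context group
begin

text \<open>For a fixed coset the choice of representative only matters up to conjugation in \<open>H\<close>, which
  characters of \<open>H\<close> do not see.\<close>

lemma transfer_factor_fixed:
  assumes H: "subgroup H G" and x: "x \<in> carrier G" and u: "u \<in> carrier G"
    and fixed: "(H #> x) #> u = H #> x" and \<phi>: "linear_char p G H \<phi>" "p > 0"
  shows "\<phi> (transfer_factor (H #> x) u) = \<phi> (x \<otimes> u \<otimes> inv x)"
proof -
  have C: "H #> x \<in> rcosets H" using rcosetsI[OF subgroup.subset[OF H] x] .
  define a where "a = coset_rep (H #> x) \<otimes> inv x"
  have rc: "coset_rep (H #> x) \<in> carrier G" using coset_rep_mem(2)[OF H C] .
  have a: "a \<in> H" unfolding a_def using mem_rcoset_iff[OF H rc x] coset_rep_mem(3)[OF H C] by simp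
  have ac: "a \<in> carrier G" using subgroup.mem_carrier[OF H a] .
  have "H #> (x \<otimes> u) = H #> x" using fixed coset_mult_assoc[OF subgroup.subset[OF H] x u] by simp
  then have xu: "x \<otimes> u \<otimes> inv x \<in> H" using mem_rcoset_iff[OF H _ x] x u by simp
  have "coset_rep (H #> x) = a \<otimes> x" unfolding a_def using rc x by (simp add: m_assoc)
  then have "transfer_factor (H #> x) u = a \<otimes> (x \<otimes> u \<otimes> inv x) \<otimes> inv a"
    unfolding transfer_factor_def fixed using conj_conj[OF ac x u] by simp
  then show ?thesis using linear_char_conj[OF \<phi> H a xu] by simp
qed

text \<open>The product telescopes by the cocycle identity.\<close>

lemma prod_transfer_factor_cycle:
  assumes H: "subgroup H G" and C: "C \<in> rcosets H" and u: "u \<in> carrier G"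
    and \<phi>: "linear_char p G H \<phi>" "p > 0"
  shows "(\<Prod>i<r::nat. \<phi> (transfer_factor (C #> u [^] i) u)) = \<phi> (transfer_factor C (u [^] r))"
proof (induction r)
  case 0
  then show ?case using transfer_factor_one[OF H C] linear_char_one[OF \<phi> H] by simp
next
  case (Suc r)
  have ur: "u [^] r \<in> carrier G" using u by simp
  show ?case
    using Suc transfer_factor_mult[OF H C ur u] transfer_factor_mem[OF H C ur]
      transfer_factor_mem[OF H rcosets_translate[OF H C ur] u] linear_char_mult[OF \<phi>(1)] by simp
qed

text \<open>A cycle of length \<open>r\<close> contributes the value of \<open>\<phi>\<close> at a conjugate of \<open>u [^] r\<close>, whose order
  is smaller than that of \<open>u\<close> when \<open>r > 1\<close>.\<close>

lemma prod_transfer_factor_nonfixed: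
  assumes p: "Factorial_Ring.prime p" and fin: "finite (carrier G)" and H: "subgroup H G"
    and \<phi>: "linear_char p G H \<phi>" and u: "u \<in> carrier G" "u [^] (p ^ Suc m) = \<one>"
    and small: "\<And>w. w \<in> H \<Longrightarrow> w [^] (p ^ m) = \<one> \<Longrightarrow> \<phi> w = 1"
  shows "(\<Prod>C\<in>{C \<in> rcosets H. C #> u \<noteq> C}. \<phi> (transfer_factor C u)) = 1"
proof (rule prod_eq_1_by_cycles[where \<tau> = "\<lambda>C. C #> u" and N = "p ^ Suc m"])
  have p0: "p > 0" using p by (rule prime_gt_0_nat)
  note tr = rcosets_translate[OF H]
  note trm = rcosets_translate_assoc[OF H]
  have one: "C #> \<one> = C" if "C \<in> rcosets H" for C
    using subgroup.rcosets_carrier[OF H is_group that] by (rule coset_mult_one)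
  have iter: "((\<lambda>C. C #> u) ^^ i) C = C #> u [^] i" if "C \<in> rcosets H" for C i
    by (induction i) (use that u trm one in simp_all)
  show "finite {C \<in> rcosets H. C #> u \<noteq> C}"
    using finite_rcosets[OF fin H] by simp
  show "p ^ Suc m > 0" using p0 by simp
  fix C assume "C \<in> {C \<in> rcosets H. C #> u \<noteq> C}"
  then have C: "C \<in> rcosets H" "C #> u \<noteq> C" by auto
  have "C #> u #> u \<noteq> C #> u"
  proof
    assume "C #> u #> u = C #> u"
    then have "C #> u #> u #> inv u = C #> u #> inv u" by simp
    then show False using C u trm[OF tr[OF C(1) u(1)]] trm[OF C(1)] one tr[OF C(1) u(1)] by simp
  qed
  then show "C #> u \<in> {C \<in> rcosets H. C #> u \<noteq> C}" using tr[OF C(1) u(1)] by simp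
  show per: "((\<lambda>C. C #> u) ^^ p ^ Suc m) C = C" using iter[OF C(1)] u(2) one[OF C(1)] by simp
  fix r :: nat
  assume r: "r > 0" "((\<lambda>C. C #> u) ^^ r) C = C"
    and min: "\<And>j. 0 < j \<Longrightarrow> j < r \<Longrightarrow> ((\<lambda>C. C #> u) ^^ j) C \<noteq> C"
  have "((\<lambda>C. C #> u) ^^ (p ^ Suc m mod r)) C = C"
    using per funpow_mod_eq[OF r(2), of "p ^ Suc m"] by simp
  then have "p ^ Suc m mod r = 0" using min[of "p ^ Suc m mod r"] r(1) by (cases "p ^ Suc m mod r = 0") auto
  \<comment> \<open>The cycle length is a power of \<open>p\<close> other than \<open>1\<close>, so it contributes an element of smaller order.\<close>
  then have "r dvd p ^ Suc m" by auto
  then obtain j where j: "r = p ^ j" using divides_primepow_nat[OF p] by blast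
  have "j \<noteq> 0" using j r(2) C(2) by (cases j) auto
  then obtain q where q: "r = p * q" using j by (cases j) auto
  have Cr: "C #> u [^] r = C" using r(2) iter[OF C(1)] by simp
  have xc: "coset_rep C \<in> carrier G" using coset_rep_mem(2)[OF H C(1)] .
  define w where "w = transfer_factor C (u [^] r)"
  have wH: "w \<in> H" unfolding w_def using transfer_factor_mem[OF H C(1)] u(1) by simp
  have "w [^] (p ^ m) = coset_rep C \<otimes> (u [^] r) [^] (p ^ m) \<otimes> inv (coset_rep C)"
    unfolding w_def transfer_factor_def Cr using conj_pow[OF xc, of "u [^] r"] u(1) by simp
  also have "(u [^] r) [^] (p ^ m) = (u [^] (p ^ Suc m)) [^] q"
    using u(1) q by (simp add: nat_pow_pow ac_simps)
  finally have "w [^] (p ^ m) = \<one>" using u(2) xc by simp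
  then have "\<phi> w = 1" using small[OF wH] by simp
  then show "(\<Prod>i<r. \<phi> (transfer_factor (((\<lambda>C. C #> u) ^^ i) C) u)) = 1"
    using prod_transfer_factor_cycle[OF H C(1) u(1) \<phi> p0] iter[OF C(1)] by (simp add: w_def)
qed

text \<open>If \<open>D\<close> is the stabilizer in \<open>P\<close> of a coset, such a \<open>t\<close> permutes the orbit of the coset in cycles
  of length \<open>p\<close>, and the factors of the transfer cancel along every cycle.\<close>

definition cancelling_element :: "nat \<Rightarrow> 'a set \<Rightarrow> 'a set \<Rightarrow> 'a \<Rightarrow> bool" where
  "cancelling_element p P D t \<longleftrightarrow>
     t \<in> P \<and> t \<notin> D \<and> t [^] p \<in> D \<and> (\<forall>w\<in>P. t \<otimes> w \<otimes> inv t \<in> D \<longleftrightarrow> w \<in> D) \<and>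
     (\<forall>\<chi> v. linear_char p G D \<chi> \<longrightarrow> v \<in> D \<longrightarrow> (\<Prod>i<p. \<chi> (t [^] i \<otimes> v \<otimes> inv (t [^] i))) = 1)"

text \<open>The permutation of the orbit induced by \<open>t\<close> preserves the cosets fixed by \<open>u\<close>, because \<open>t\<close>
  normalizes the stabilizer. It has no fixed points and order \<open>p\<close>, so all its cycles have length
  \<open>p\<close>, and on a cycle of fixed cosets the factors are the values of one character of \<open>D\<close> at the
  conjugates of one element by powers of \<open>t\<close>.\<close>

lemma prod_transfer_factor_fixed_orbit:
  assumes p: "Factorial_Ring.prime p" and fin: "finite (carrier G)"
    and H: "subgroup H G" and P: "subgroup P G" and \<phi>: "linear_char p G H \<phi>"
    and u: "u \<in> P" and x: "x \<in> carrier G" and D: "D = {g \<in> P. x \<otimes> g \<otimes> inv x \<in> H}"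
    and canc_t: "cancelling_element p P D t"
  shows "(\<Prod>C\<in>(\<lambda>g. H #> x #> g) ` P. if C #> u = C then \<phi> (transfer_factor C u) else 1) = 1"
    (is "prod ?h ?X = 1")
proof -
  have t: "t \<in> P" "t \<notin> D" "t [^] p \<in> D"
    and nt: "\<And>w. w \<in> P \<Longrightarrow> t \<otimes> w \<otimes> inv t \<in> D \<longleftrightarrow> w \<in> D"
    and canc: "\<And>\<chi> v. linear_char p G D \<chi> \<Longrightarrow> v \<in> D \<Longrightarrow>
       (\<Prod>i<p. \<chi> (t [^] i \<otimes> v \<otimes> inv (t [^] i))) = 1"
    using canc_t unfolding cancelling_element_def by blast+
  have p0: "p > 0" using p by (rule prime_gt_0_nat)
  note Pc = subgroup.mem_carrier[OF P] and Pm = subgroup.m_closed[OF P] and Pi = subgroup.m_inv_closed[OF P]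
  have tc: "t \<in> carrier G" and uc: "u \<in> carrier G" using Pc t u by auto
  have Hc: "H \<subseteq> carrier G" by (rule subgroup.subset[OF H])
  have tP: "t [^] i \<in> P" for i :: nat using subgroup_int_pow_closed[OF P t(1)] by (metis int_pow_int)
  have Hx: "H #> x #> g = H #> (x \<otimes> g)" if "g \<in> carrier G" for g using coset_mult_assoc[OF Hc x that] .
  have eqD: "H #> x #> g = H #> x #> g' \<longleftrightarrow> g \<otimes> inv g' \<in> D" if "g \<in> P" "g' \<in> P" for g g'
  proof -
    have gc: "g \<in> carrier G" "g' \<in> carrier G" using that Pc by auto
    have "x \<otimes> g \<otimes> inv (x \<otimes> g') = x \<otimes> (g \<otimes> inv g') \<otimes> inv x"
      using x gc by (simp add: m_assoc inv_mult_group)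
    then show ?thesis
      unfolding Hx[OF gc(1)] Hx[OF gc(2)] D using mem_rcoset_iff[OF H] x gc that Pm Pi by simp
  qed
  \<comment> \<open>The orbit is a copy of the set of right cosets of \<open>D\<close> in \<open>P\<close>, and \<open>\<tau>\<close> is left multiplication
    by \<open>t\<close> on it, which is well defined because \<open>t\<close> normalizes \<open>D\<close>.\<close>
  define \<tau> where "\<tau> y = H #> x #> (t \<otimes> (SOME g. g \<in> P \<and> H #> x #> g = y))" for y
  have \<tau>1: "\<tau> (H #> x #> g) = H #> x #> (t \<otimes> g)" if g: "g \<in> P" for g
  proof -
    define g' where "g' = (SOME g'. g' \<in> P \<and> H #> x #> g' = H #> x #> g)"
    have g': "g' \<in> P \<and> H #> x #> g' = H #> x #> g"
      unfolding g'_def by (rule someI[of _ g]) (use g in simp)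
    then have gD: "g' \<otimes> inv g \<in> D" using eqD[of g' g] g by blast
    have "(t \<otimes> g') \<otimes> inv (t \<otimes> g) = t \<otimes> (g' \<otimes> inv g) \<otimes> inv t"
      using tc Pc g g' by (simp add: m_assoc inv_mult_group)
    then have "(t \<otimes> g') \<otimes> inv (t \<otimes> g) \<in> D" using nt gD g g' Pm Pi by simp
    then show ?thesis unfolding \<tau>_def g'_def[symmetric] using eqD[OF Pm[OF t(1)] Pm[OF t(1) g]] g' by blast
  qed
  have iter: "(\<tau> ^^ i) (H #> x #> g) = H #> x #> (t [^] i \<otimes> g)" if g: "g \<in> P" for g i
  proof (induction i)
    case (Suc i)
    have "t \<otimes> (t [^] i \<otimes> g) = t [^] Suc i \<otimes> g"
      using tc Pc[OF g] by (simp add: m_assoc[symmetric] nat_pow_Suc2[symmetric])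
    then show ?case using Suc \<tau>1[OF Pm[OF tP g]] by simp
  qed (use Pc[OF g] in simp)
  have iter_eq: "(\<tau> ^^ i) (H #> x #> g) = H #> x #> g \<longleftrightarrow> t [^] i \<in> D" if g: "g \<in> P" for g i
    unfolding iter[OF g] using eqD[OF Pm[OF tP g] g] Pc[OF g] tc by (simp add: m_assoc)
  have ntpow: "t [^] i \<otimes> w \<otimes> inv (t [^] i) \<in> D \<longleftrightarrow> w \<in> D" if w: "w \<in> P" for w and i :: nat
    using w
  proof (induction i arbitrary: w)
    case (Suc i)
    have "t [^] Suc i \<otimes> w \<otimes> inv (t [^] Suc i) = t [^] i \<otimes> (t \<otimes> w \<otimes> inv t) \<otimes> inv (t [^] i)"
      using conj_conj[of "t [^] i" t w] tc Pc[OF Suc.prems] by simp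
    then show ?case using Suc.IH[of "t \<otimes> w \<otimes> inv t"] nt[OF Suc.prems] Suc.prems Pm Pi t(1) by simp
  qed (use Pc in simp)
  show ?thesis
  proof (rule prod_eq_1_by_cycles[where \<tau> = \<tau> and N = p])
    show "finite ?X" using finite_subset[OF subgroup.subset[OF P] fin] by simp
    show "p > 0" by (rule p0)
    fix y assume "y \<in> ?X"
    then obtain g where g: "g \<in> P" and y: "y = H #> x #> g" by blast
    show "\<tau> y \<in> ?X" unfolding y \<tau>1[OF g] using Pm[OF t(1) g] by blast
    show per: "(\<tau> ^^ p) y = y" unfolding y iter_eq[OF g] by (rule t(3))
    fix r :: nat
    assume r: "r > 0" "(\<tau> ^^ r) y = y" and min: "\<And>j. 0 < j \<Longrightarrow> j < r \<Longrightarrow> (\<tau> ^^ j) y \<noteq> y"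
    have "(\<tau> ^^ (p mod r)) y = y" using per funpow_mod_eq[OF r(2), of p] by simp
    then have "p mod r = 0" using min[of "p mod r"] r(1) by (cases "p mod r = 0") auto
    then have "r dvd p" by auto
    moreover have "r \<noteq> 1"
    proof
      assume "r = 1"
      then have "t [^] (1::nat) \<in> D" using r(2) iter_eq[OF g, of 1] unfolding y by blast
      then show False using t(2) tc by simp
    qed
    ultimately have rp: "r = p" using p by (metis prime_nat_iff)
    define v where "v = g \<otimes> u \<otimes> inv g"
    have v: "v \<in> P" unfolding v_def using Pm Pi g u by simp
    have gc: "g \<in> carrier G" using Pc[OF g] .
    have cj: "(t [^] i \<otimes> g) \<otimes> u \<otimes> inv (t [^] i \<otimes> g) = t [^] i \<otimes> v \<otimes> inv (t [^] i)" for i :: nat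
      unfolding v_def using conj_conj[of "t [^] i" g u] tc gc uc by simp
    have fix_iff: "(\<tau> ^^ i) y #> u = (\<tau> ^^ i) y \<longleftrightarrow> v \<in> D" for i
    proof -
      have gi: "t [^] i \<otimes> g \<in> P" using Pm tP g by simp
      have "H #> x #> (t [^] i \<otimes> g) #> u = H #> x #> (t [^] i \<otimes> g \<otimes> u)"
        using coset_mult_assoc[OF r_coset_subset_G[OF Hc x] Pc[OF gi] uc] .
      then show ?thesis
        unfolding y iter[OF g] using eqD[OF Pm[OF gi u] gi] cj[of i] ntpow[OF v, of i] by simp
    qed
    show "(\<Prod>i<r. ?h ((\<tau> ^^ i) y)) = 1"
    proof (cases "v \<in> D")
      case False
      then show ?thesis by (simp add: fix_iff)
    next
      case True
      define \<mu> where "\<mu> w = \<phi> (x \<otimes> w \<otimes> inv x)" for w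
      have \<mu>: "linear_char p G D \<mu>"
        unfolding linear_char_def
      proof (intro conjI ballI)
        fix a b assume a: "a \<in> D" and b: "b \<in> D"
        then show "\<mu> (a \<otimes> b) = \<mu> a * \<mu> b"
          unfolding \<mu>_def using conj_mult[OF x, of a b] linear_char_mult[OF \<phi>] Pc D by simp
      next
        fix a assume "a \<in> D"
        then show "\<mu> a ^ p = 1" unfolding \<mu>_def using linear_char_power_eq_1[OF \<phi>] D by simp
      qed
      have "?h ((\<tau> ^^ i) y) = \<mu> (t [^] i \<otimes> v \<otimes> inv (t [^] i))" for i
      proof -
        have gi: "t [^] i \<otimes> g \<in> carrier G" using tc gc by simp
        have yi: "(\<tau> ^^ i) y = H #> (x \<otimes> (t [^] i \<otimes> g))" unfolding y iter[OF g] Hx[OF gi] by simp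
        have fx: "H #> (x \<otimes> (t [^] i \<otimes> g)) #> u = H #> (x \<otimes> (t [^] i \<otimes> g))"
          using fix_iff[of i] True unfolding yi by simp
        have "?h ((\<tau> ^^ i) y) = \<phi> ((x \<otimes> (t [^] i \<otimes> g)) \<otimes> u \<otimes> inv (x \<otimes> (t [^] i \<otimes> g)))"
          unfolding yi using fx transfer_factor_fixed[OF H _ uc fx \<phi> p0] x gi by simp
        also have "\<dots> = \<mu> (t [^] i \<otimes> v \<otimes> inv (t [^] i))"
          unfolding \<mu>_def conj_conj[OF x gi uc] cj ..
        finally show ?thesis .
      qed
      then show ?thesis using canc[OF \<mu> True] rp by simp
    qed
  qed
qed

text \<open>Cosets moved by \<open>u\<close> contribute \<open>1\<close>, and so does each orbit of \<open>P\<close> on the cosets other than \<open>H\<close>.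
  What remains is the factor of \<open>H\<close> itself.\<close>

lemma transfer_char_value:
  assumes p: "Factorial_Ring.prime p" and fin: "finite (carrier G)"
    and H: "subgroup H G" and P: "subgroup P G" "P \<subseteq> H" and \<phi>: "linear_char p G H \<phi>"
    and u: "u \<in> P" "u [^] (p ^ Suc m) = \<one>"
    and small: "\<And>w. w \<in> H \<Longrightarrow> w [^] (p ^ m) = \<one> \<Longrightarrow> \<phi> w = 1"
    and loc: "\<And>x. x \<in> carrier G \<Longrightarrow> x \<notin> H \<Longrightarrow>
      \<exists>t. cancelling_element p P {g \<in> P. x \<otimes> g \<otimes> inv x \<in> H} t"
  shows "(\<Prod>C\<in>rcosets H. \<phi> (transfer_factor C u)) = \<phi> u"
proof -
  have p0: "p > 0" using p by (rule prime_gt_0_nat)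
  note Pc = subgroup.mem_carrier[OF P(1)] and Pm = subgroup.m_closed[OF P(1)] and Pi = subgroup.m_inv_closed[OF P(1)]
  have uc: "u \<in> carrier G" using Pc u by simp
  have Hc: "H \<subseteq> carrier G" by (rule subgroup.subset[OF H])
  have finR: "finite (rcosets H)" by (rule finite_rcosets[OF fin H])
  let ?f = "\<lambda>C. \<phi> (transfer_factor C u)"
  let ?h = "\<lambda>C. if C #> u = C then ?f C else 1"
  let ?\<Omega> = "rcosets H - {H}"
  let ?O = "\<lambda>C. (\<lambda>g. C #> g) ` P"
  have HR: "H \<in> rcosets H" using rcosetsI[OF Hc one_closed] coset_mult_one[OF Hc] by simp
  have "prod ?f (rcosets H) = prod ?f {C \<in> rcosets H. C #> u \<noteq> C} * prod ?f {C \<in> rcosets H. C #> u = C}"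
    by (subst prod.union_disjoint[symmetric]) (use finR in \<open>auto intro: prod.cong\<close>)
  also have "prod ?f {C \<in> rcosets H. C #> u \<noteq> C} = 1"
    by (rule prod_transfer_factor_nonfixed[OF p fin H \<phi> uc u(2) small])
  also have "prod ?f {C \<in> rcosets H. C #> u = C} = prod ?h (rcosets H)"
    using prod.inter_filter[OF finR, of ?f "\<lambda>C. C #> u = C"] by simp
  also have "prod ?h (rcosets H) = ?h H * prod ?h ?\<Omega>"
    by (rule prod.remove[OF finR HR])
  also have "?h H = \<phi> u"
  proof -
    have "H #> \<one> #> u = H #> \<one>"
      using coset_join2[OF uc H] u(1) P(2) coset_mult_one[OF Hc] by auto
    then show ?thesis
      using transfer_factor_fixed[OF H one_closed uc _ \<phi> p0] coset_mult_one[OF Hc] uc by simp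
  qed
  also have "prod ?h ?\<Omega> = 1"
  proof -
    have "prod ?h {C \<in> ?\<Omega>. ?O C = Q} = 1" if Q: "Q \<in> ?O ` ?\<Omega>" for Q
    proof -
      obtain C0 where C0: "C0 \<in> rcosets H" "C0 \<noteq> H" "Q = ?O C0" using Q by blast
      obtain x where x: "x \<in> carrier G" "C0 = H #> x" using C0(1) unfolding RCOSETS_def by blast
      have xH: "x \<notin> H" using C0(2) x coset_join2[OF x(1) H] by blast
      note trm = rcosets_translate_assoc[OF H C0(1)]
      have fib: "{C \<in> ?\<Omega>. ?O C = Q} = ?O C0"
      proof (intro equalityI subsetI)
        fix C assume C: "C \<in> {C \<in> ?\<Omega>. ?O C = Q}"
        have "C #> \<one> = C" using C subgroup.rcosets_carrier[OF H is_group] coset_mult_one by simp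
        then have "C \<in> ?O C" using subgroup.one_closed[OF P(1)] by (metis imageI)
        then show "C \<in> ?O C0" using C C0(3) by simp
      next
        fix C assume "C \<in> ?O C0"
        then obtain g where g: "g \<in> P" "C = C0 #> g" by blast
        have gc: "g \<in> carrier G" using Pc[OF g(1)] .
        have CR: "C \<in> rcosets H" unfolding g(2) by (rule rcosets_translate[OF H C0(1) gc])
        have undo: "C #> inv g = C0"
          unfolding g(2) using trm[OF gc inv_closed[OF gc]] gc
            subgroup.rcosets_carrier[OF H is_group C0(1)] by (simp add: coset_mult_one)
        have "C \<noteq> H"
        proof
          assume "C = H"
          then have "C0 = H #> inv g" using undo by simp
          also have "\<dots> = H" using coset_join2[OF inv_closed[OF gc] H] Pi[OF g(1)] P(2) by blast
          finally show False using C0(2) by simp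
        qed
        moreover have "?O C = ?O C0"
        proof (intro equalityI subsetI)
          fix B assume "B \<in> ?O C"
          then obtain k where k: "k \<in> P" "B = C #> k" by blast
          then have "B = C0 #> (g \<otimes> k)" unfolding g(2) using trm[OF gc Pc[OF k(1)]] by simp
          then show "B \<in> ?O C0" using Pm[OF g(1) k(1)] by blast
        next
          fix B assume "B \<in> ?O C0"
          then obtain k where k: "k \<in> P" "B = C0 #> k" by blast
          then have "B = C #> (inv g \<otimes> k)"
            using rcosets_translate_assoc[OF H CR inv_closed[OF gc] Pc[OF k(1)]] undo by simp
          then show "B \<in> ?O C" using Pm[OF Pi[OF g(1)] k(1)] by blast
        qed
        ultimately show "C \<in> {C \<in> ?\<Omega>. ?O C = Q}" using CR C0(3) by simp
      qed
      obtain t where t: "cancelling_element p P {g \<in> P. x \<otimes> g \<otimes> inv x \<in> H} t"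
        using loc[OF x(1) xH] by blast
      show ?thesis
        unfolding fib x(2)
        by (rule prod_transfer_factor_fixed_orbit[OF p fin H P(1) \<phi> u(1) x(1) refl t])
    qed
    then show ?thesis using prod.image_gen[of ?\<Omega> ?h ?O] finR by simp
  qed
  finally show ?thesis by simp
qed

end

section \<open>Abelian p-quotients\<close>

context group
begin

lemma pow_index_mem_normal:
  assumes N: "N \<lhd> G" and x: "x \<in> carrier G"
  shows "x [^] card (rcosets N) \<in> N"
proof -
  interpret N: normal N G by (rule N)
  interpret Q: group "G Mod N" by (rule N.factorgroup_is_group)
  interpret h: group_hom G "G Mod N" "\<lambda>g. N #> g"
    by (simp add: group_hom_def group_hom_axioms_def is_group Q.is_group N.r_coset_hom_Mod)
  have o: "order (G Mod N) = card (rcosets N)" by (simp add: order_def FactGroup_def)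
  have "N #> x [^] card (rcosets N) = N"
    using h.hom_nat_pow[OF x, of "card (rcosets N)"] Q.pow_order_eq_1[OF h.hom_closed[OF x]] o
    by (simp add: FactGroup_def)
  then show ?thesis using rcos_self[OF _ N.is_subgroup, of "x [^] card (rcosets N)"] x by simp
qed

lemma abelian_p_quotient_kernel:
  assumes hom: "group_hom G A h" and p: "Factorial_Ring.prime p"
    and A: "comm_group A" and ord: "order A = p ^ k"
  shows "abelian_p_quotient p G (kernel G A h)"
    and "order (G Mod kernel G A h) = card (h ` carrier G)"
proof -
  interpret A: comm_group A by (rule A)
  interpret h: group_hom G A h by (rule hom)
  let ?I = "A\<lparr>carrier := h ` carrier G\<rparr>"
  have I: "subgroup (h ` carrier G) A" by (rule h.img_is_subgroup)
  interpret I: group ?I by (rule A.subgroup_imp_group[OF I])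
  have cI: "comm_group ?I"
    by (rule I.group_comm_groupI) (use A.m_comm in auto)
  have hI: "group_hom G ?I h"
    by (simp add: group_hom_def group_hom_axioms_def is_group I.is_group hom_def h.hom_mult)
  have ker: "kernel G ?I h = kernel G A h" by (simp add: kernel_def)
  interpret K: normal "kernel G A h" G by (rule h.normal_kernel)
  interpret Q: group "G Mod kernel G A h" by (rule K.factorgroup_is_group)
  have iso: "G Mod kernel G A h \<cong> ?I"
    using group_hom.FactGroup_iso[OF hI] ker by simp
  show c: "order (G Mod kernel G A h) = card (h ` carrier G)"
    using iso_same_card[OF iso] by (simp add: order_def)
  have "comm_group (G Mod kernel G A h)"
    using comm_group.iso_imp_comm_group[OF cI Q.iso_sym[OF iso]] Q.monoid_axioms by simp
  moreover have "card (h ` carrier G) dvd p ^ k"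
    using A.lagrange[OF I] unfolding ord by (rule dvdI[OF trans[OF sym mult.commute]])
  then have "\<exists>j. order (G Mod kernel G A h) = p ^ j"
    unfolding c divides_primepow_nat[OF p] by blast
  ultimately show "abelian_p_quotient p G (kernel G A h)"
    using h.normal_kernel by (simp add: abelian_p_quotient_def)
qed

end

text \<open>Characters of order \<open>p\<close> detect proper subgroups of a finite abelian \<open>p\<close>-group; this reduces
  surjectivity of the transfer to a statement about a single character.\<close>

lemma (in comm_group) nontrivial_char_trivial_on_proper_subgroup:
  assumes p: "Factorial_Ring.prime p" and ord: "order G = p ^ n"
    and I: "subgroup I G" "I \<noteq> carrier G"
  obtains \<chi> a where "linear_char p G (carrier G) \<chi>" "\<And>x. x \<in> I \<Longrightarrow> \<chi> x = 1"
    "a \<in> carrier G" "\<chi> a \<noteq> 1"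
proof -
  have p0: "p > 0" using p by (rule prime_gt_0_nat)
  have fin: "finite (carrier G)" using ord p0 order_gt_0_iff_finite by simp
  let ?S = "\<lambda>M. subgroup M G \<and> M \<noteq> carrier G \<and> I \<subseteq> M"
  \<comment> \<open>Above a maximal proper subgroup \<open>M\<close> the group is cyclic of order \<open>p\<close>, so a root of unity does.\<close>
  obtain M where M: "?S M" and max: "\<And>E. ?S E \<Longrightarrow> card E \<le> card M"
  proof -
    have "\<exists>M. ?S M \<and> (\<forall>E. ?S E \<longrightarrow> card E \<le> card M)"
    proof (rule ex_has_greatest_nat[of ?S I card "Suc (order G)"])
      show "\<forall>E. ?S E \<longrightarrow> card E < Suc (order G)"
        using card_mono[OF fin subgroup.subset] by (simp add: order_def less_Suc_eq_le)
    qed (use I in simp)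
    then show thesis using that by blast
  qed
  have Ms: "subgroup M G" using M by simp
  note Mc = subgroup.mem_carrier[OF Ms] and Mm = subgroup.m_closed[OF Ms] and Mi = subgroup.m_inv_closed[OF Ms]
  obtain g where g: "g \<in> carrier G" "g \<notin> M" using M subgroup.subset[OF Ms] by blast
  have "g [^] (p ^ n) \<in> M" using pow_order_eq_1[OF g(1)] ord subgroup.one_closed[OF Ms] by simp
  then obtain m where m: "g [^] (p ^ m) \<notin> M" "(g [^] (p ^ m)) [^] p \<in> M"
    using first_p_power_in[OF g] by blast
  define a where "a = g [^] (p ^ m)"
  have a: "a \<in> carrier G" "a \<notin> M" "a [^] p \<in> M" using g m by (simp_all add: a_def)
  let ?E = "M <#> range (\<lambda>k::nat. a [^] k)"
  have Es: "subgroup ?E G" by (rule mult_subgroups[OF Ms subgroup_nat_powers[OF fin a(1)]])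
  have E: "?E = carrier G"
  proof (rule ccontr)
    assume ne: "?E \<noteq> carrier G"
    have inE: "m \<otimes> a [^] k \<in> ?E" if "m \<in> M" for m and k :: nat
      unfolding set_mult_def using that by auto
    have sub: "M \<subseteq> ?E"
    proof
      fix x assume x: "x \<in> M"
      show "x \<in> ?E" using inE[OF x, of 0] Mc[OF x] by simp
    qed
    have "a \<in> ?E" using inE[OF subgroup.one_closed[OF Ms], of 1] a(1) by simp
    then have "card M < card ?E"
      using sub a(2) psubset_card_mono[OF finite_subset[OF subgroup.subset[OF Es] fin]] by blast
    moreover have "card ?E \<le> card M" by (rule max) (use Es ne sub M in blast)
    ultimately show False by simp
  qed
  have dvd: "p dvd d" if "a [^] d \<in> M" for d :: nat
  proof (rule ccontr)
    assume "\<not> p dvd d"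
    then have "coprime p d" using p by (simp add: prime_imp_coprime)
    then show False using mem_subgroup_of_coprime_pow[OF Ms a(1,3) that] a(2) by simp
  qed
  obtain \<omega> :: complex where \<omega>: "\<omega> ^ p = 1" "\<omega> \<noteq> 1" using nontrivial_root_of_unity[OF p] .
  define \<chi> where "\<chi> y = \<omega> ^ (SOME i. \<exists>m\<in>M. y = m \<otimes> a [^] (i::nat))" for y
  have le: "\<omega> ^ i = \<omega> ^ j"
    if "j \<le> i" "m \<in> M" "m' \<in> M" "m \<otimes> a [^] i = m' \<otimes> a [^] j" for i j :: nat and m m'
  proof -
    have mc: "m \<in> carrier G" "m' \<in> carrier G" using that Mc by auto
    have "m \<otimes> a [^] (i - j) \<otimes> a [^] j = m' \<otimes> a [^] j"
      using that a(1) mc by (simp add: m_assoc nat_pow_mult)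
    then have "m \<otimes> a [^] (i - j) = m'" using a(1) mc by (metis m_closed nat_pow_closed right_cancel)
    then have "a [^] (i - j) = inv m \<otimes> m'" using a(1) mc by (metis inv_cancel_left(1) nat_pow_closed)
    then have "p dvd i - j" using dvd Mm Mi that by simp
    then obtain q where "i - j = p * q" by (rule dvdE)
    then have "i = p * q + j" using that(1) by simp
    then show ?thesis using \<omega>(1) by (simp add: power_add power_mult)
  qed
  have \<chi>: "\<chi> (m \<otimes> a [^] i) = \<omega> ^ i" if m: "m \<in> M" for m and i :: nat
  proof -
    define j where "j = (SOME j. \<exists>m'\<in>M. m \<otimes> a [^] i = m' \<otimes> a [^] (j::nat))"
    have "\<exists>m'\<in>M. m \<otimes> a [^] i = m' \<otimes> a [^] j"
      unfolding j_def by (rule someI[of _ i]) (use m in blast)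
    then obtain m' where m': "m' \<in> M" "m \<otimes> a [^] i = m' \<otimes> a [^] j" by blast
    have "\<omega> ^ i = \<omega> ^ j"
      using le[of j i m m'] le[of i j m' m] m m' by (cases "j \<le> i") auto
    then show ?thesis by (simp add: \<chi>_def j_def)
  qed
  have rep: "\<exists>m\<in>M. \<exists>i::nat. y = m \<otimes> a [^] i" if "y \<in> carrier G" for y
    using that E unfolding set_mult_def by blast
  show thesis
  proof (rule that[of \<chi> a])
    show "linear_char p G (carrier G) \<chi>"
      unfolding linear_char_def
    proof (intro conjI ballI)
      fix x y assume "x \<in> carrier G" "y \<in> carrier G"
      then obtain m i m' j where x: "m \<in> M" "x = m \<otimes> a [^] (i::nat)"
        and y: "m' \<in> M" "y = m' \<otimes> a [^] (j::nat)" using rep by meson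
      have "x \<otimes> y = (m \<otimes> m') \<otimes> a [^] (i + j)"
        using x y Mc a(1) by (simp add: nat_pow_mult[symmetric] m_ac)
      then show "\<chi> (x \<otimes> y) = \<chi> x * \<chi> y"
        using x y \<chi> Mm by (simp add: power_add)
    next
      fix x assume "x \<in> carrier G"
      then obtain m i where x: "m \<in> M" "x = m \<otimes> a [^] (i::nat)" using rep by meson
      have "(\<omega> ^ i) ^ p = (\<omega> ^ p) ^ i" by (simp add: power_mult[symmetric] mult.commute)
      then show "\<chi> x ^ p = 1" using x \<chi> \<omega>(1) by simp
    qed
    show "\<chi> x = 1" if "x \<in> I" for x
      using \<chi>[of x 0] that M Mc by auto
    show "a \<in> carrier G" by (rule a(1))
    show "\<chi> a \<noteq> 1" using \<chi>[of \<one> 1] subgroup.one_closed[OF Ms] a(1) \<omega>(2) by simp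
  qed
qed

section \<open>Sylow subgroups\<close>

context group
begin

lemma sylow_index_coprime:
  assumes fin: "finite (carrier G)" and p: "Factorial_Ring.prime p"
    and P: "sylow_subgroup p G P" and N: "subgroup N G" "P \<subseteq> N"
  shows "coprime (card (rcosets N)) p"
    and "coprime (card (rcosets\<^bsub>G\<lparr>carrier := N\<rparr>\<^esub> P)) p"
proof -
  have Ps: "subgroup P G" and cP: "card P = p ^ multiplicity p (order G)"
    using P by (auto simp: sylow_subgroup_def)
  interpret N: group "G\<lparr>carrier := N\<rparr>" by (rule subgroup_imp_group[OF N(1)])
  let ?r = "card (rcosets N)" and ?s = "card (rcosets\<^bsub>G\<lparr>carrier := N\<rparr>\<^esub> P)"
  have 1: "?r * card N = order G" by (rule lagrange[OF N(1)])
  have 2: "?s * card P = card N"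
    using N.lagrange[OF subgroup_incl[OF Ps N]] by (simp add: order_def)
  have o: "order G \<noteq> 0" using fin order_gt_0_iff_finite by simp
  have e: "order G = ?r * ?s * p ^ multiplicity p (order G)"
    using 1 2 cP by (metis mult.assoc)
  have "\<not> p dvd ?r * ?s"
  proof
    assume "p dvd ?r * ?s"
    then have "p ^ Suc (multiplicity p (order G)) dvd order G"
      by (subst e) (simp add: mult_dvd_mono)
    moreover have "\<not> is_unit p" using p by auto
    ultimately show False
      using power_dvd_iff_le_multiplicity[of "order G" p "Suc (multiplicity p (order G))"] o by simp
  qed
  then have "\<not> p dvd ?r" "\<not> p dvd ?s" by auto
  then show "coprime ?r p" "coprime ?s p"
    using p by (simp_all add: coprime_commute prime_imp_coprime)
qed

lemma sylow_pow_eq_one: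
  assumes P: "sylow_subgroup p G P" and g: "g \<in> P"
  shows "g [^] (p ^ multiplicity p (order G)) = \<one>"
proof -
  have Ps: "subgroup P G" and cP: "card P = p ^ multiplicity p (order G)"
    using P by (auto simp: sylow_subgroup_def)
  interpret P: group "G\<lparr>carrier := P\<rparr>" by (rule subgroup_imp_group[OF Ps])
  have ord: "order (G\<lparr>carrier := P\<rparr>) = p ^ multiplicity p (order G)" using cP by (simp add: order_def)
  show ?thesis
    using P.pow_order_eq_1[of g] g unfolding ord by (simp add: nat_pow_consistent[symmetric])
qed

text \<open>A power of \<open>w\<close> prime to \<open>p\<close> and a \<open>p\<close>-power of \<open>w\<close> both lie in \<open>P\<close>, hence so does \<open>w\<close>.\<close>

lemma p_element_of_normalizer:
  assumes fin: "finite (carrier G)" and p: "Factorial_Ring.prime p" and P: "sylow_subgroup p G P"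
    and w: "w \<in> normalizer G P" "w [^] (p ^ j :: nat) = \<one>"
  shows "w \<in> P"
proof -
  have Ps: "subgroup P G" using P by (simp add: sylow_subgroup_def)
  have N: "subgroup (normalizer G P) G" by (rule normalizer_imp_subgroup[OF subgroup.subset[OF Ps]])
  let ?N = "G\<lparr>carrier := normalizer G P\<rparr>"
  interpret N: group ?N by (rule subgroup_imp_group[OF N])
  let ?s = "card (rcosets\<^bsub>?N\<^esub> P)"
  have "w [^]\<^bsub>?N\<^esub> ?s \<in> P"
    by (rule N.pow_index_mem_normal[OF subgroup_in_normalizer[OF Ps]]) (use w in simp)
  then have "w [^] ?s \<in> P" by (simp add: nat_pow_consistent[symmetric])
  moreover have "w [^] (p ^ j) \<in> P" using w(2) subgroup.one_closed[OF Ps] by simp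
  moreover have "coprime ?s (p ^ j)"
    using sylow_index_coprime(2)[OF fin p P N subset_normalizer[OF fin Ps]] by simp
  ultimately show ?thesis
    using mem_subgroup_of_coprime_pow[OF Ps] subgroup.mem_carrier[OF N w(1)] by blast
qed

text \<open>The stabilizer in \<open>P\<close> of a coset of the normalizer is the intersection of \<open>P\<close> with another Sylow
  subgroup, so its order is bounded by that of the norm of \<open>P\<close>.\<close>

lemma cancelling_element_in_sylow:
  assumes fin: "finite (carrier G)" and p: "Factorial_Ring.prime p" and P: "sylow_subgroup p G P"
    and small: "\<And>R. sylow_subgroup p G R \<Longrightarrow> P \<noteq> R \<Longrightarrow> card (P \<inter> R) \<le> card (group_norm (G\<lparr>carrier := P\<rparr>))"
    and x: "x \<in> carrier G" "x \<notin> normalizer G P"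
  shows "\<exists>t. cancelling_element p P {g \<in> P. x \<otimes> g \<otimes> inv x \<in> normalizer G P} t"
proof -
  define D where D: "D = {g \<in> P. x \<otimes> g \<otimes> inv x \<in> normalizer G P}"
  have Ps: "subgroup P G" and cP: "card P = p ^ multiplicity p (order G)"
    using P by (auto simp: sylow_subgroup_def)
  note Pc = subgroup.mem_carrier[OF Ps]
  have finP: "finite P" using finite_subset[OF subgroup.subset[OF Ps] fin] .
  let ?P = "G\<lparr>carrier := P\<rparr>"
  interpret P: group ?P by (rule subgroup_imp_group[OF Ps])
  have ord: "order ?P = p ^ multiplicity p (order G)" using cP by (simp add: order_def)
  note pow1 = sylow_pow_eq_one[OF P]
  \<comment> \<open>\<open>p\<close>-elements of the normalizer lie in \<open>P\<close>, so \<open>D\<close> is the intersection of \<open>P\<close> with a conjugate.\<close>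
  have D': "D = {g \<in> P. x \<otimes> g \<otimes> inv x \<in> P}"
  proof -
    have "x \<otimes> g \<otimes> inv x \<in> P" if "g \<in> P" "x \<otimes> g \<otimes> inv x \<in> normalizer G P" for g
      using p_element_of_normalizer[OF fin p P that(2)] conj_pow[OF x(1) Pc[OF that(1)]] pow1[OF that(1)] x(1)
      by (metis inv_closed r_one r_inv)
    then show ?thesis using D subset_normalizer[OF fin Ps] by blast
  qed
  let ?R = "(\<lambda>h. inv x \<otimes> h \<otimes> x) ` P"
  have R: "h \<in> ?R \<longleftrightarrow> x \<otimes> h \<otimes> inv x \<in> P" if "h \<in> carrier G" for h
  proof
    assume "h \<in> ?R"
    then obtain k where "k \<in> P" "h = inv x \<otimes> k \<otimes> x" by blast
    then show "x \<otimes> h \<otimes> inv x \<in> P" using x(1) Pc by (simp add: m_assoc inv_cancel_left)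
  next
    assume k: "x \<otimes> h \<otimes> inv x \<in> P"
    have "h = inv x \<otimes> (x \<otimes> h \<otimes> inv x) \<otimes> x" using x(1) that by (simp add: m_assoc inv_cancel_left)
    then show "h \<in> ?R" using k by (rule image_eqI)
  qed
  have DR: "D = P \<inter> ?R" using R Pc D' by blast
  have Rs: "subgroup ?R G" by (rule subgroup_conjugate[OF Ps x(1)])
  have "inj_on (\<lambda>h. inv x \<otimes> h \<otimes> x) P"
    by (rule inj_onI) (use x(1) Pc in \<open>metis inv_closed Units_eq Units_l_cancel m_closed right_cancel\<close>)
  then have cR: "card ?R = card P" by (rule card_image)
  have Rsyl: "sylow_subgroup p G ?R" using Rs cR cP by (simp add: sylow_subgroup_def)
  have DneP: "D \<noteq> P"
  proof
    assume "D = P"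
    then have "x \<in> normalizer G P"
      using normalizer_iff[OF finP subgroup.subset[OF Ps]] x(1) D' by blast
    then show False using x(2) by simp
  qed
  then have "P \<noteq> ?R" using DR by blast
  then have le: "card D \<le> card (group_norm ?P)" unfolding DR by (rule small[OF Rsyl])
  have Ds: "subgroup D G" unfolding DR by (rule subgroups_Inter_pair[OF Ps Rs])
  have DsP: "subgroup D ?P" using subgroup_incl[OF Ds Ps] DR by blast
  obtain t where t: "t \<in> carrier ?P" "t \<notin> D" "t [^]\<^bsub>?P\<^esub> p \<in> D" "t \<in> normalizer ?P D"
    and canc: "\<And>\<chi> v. linear_char p ?P D \<chi> \<Longrightarrow> v \<in> D \<Longrightarrow>
       (\<Prod>i<p. \<chi> (t [^]\<^bsub>?P\<^esub> i \<otimes>\<^bsub>?P\<^esub> v \<otimes>\<^bsub>?P\<^esub> inv\<^bsub>?P\<^esub> (t [^]\<^bsub>?P\<^esub> i))) = 1"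
    by (rule P.normalizing_element_cancelling_chars[OF p ord DsP _ le]) (use DneP in auto)
  have tP: "t \<in> P" using t(1) by simp
  have pow: "t [^]\<^bsub>?P\<^esub> i = t [^] i" for i :: nat by (simp add: nat_pow_consistent[symmetric])
  have tpP: "t [^] i \<in> P" for i :: nat using P.nat_pow_closed[OF t(1), of i] by (simp add: pow)
  have invP: "inv\<^bsub>?P\<^esub> g = inv g" if "g \<in> P" for g by (rule m_inv_consistent[OF Ps that])
  have nt: "t \<otimes> w \<otimes> inv t \<in> D \<longleftrightarrow> w \<in> D" if "w \<in> P" for w
    using P.normalizer_conj_iff[OF DsP _ t(4), of w] that finite_subset[OF _ finP, of D] DR invP[OF tP] by simp
  have "(\<Prod>i<p. \<chi> (t [^] i \<otimes> v \<otimes> inv (t [^] i))) = 1" if "linear_char p G D \<chi>" "v \<in> D" for \<chi> v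
    using canc[of \<chi> v] that by (simp add: linear_char_def pow invP[OF tpP])
  then have "cancelling_element p P D t"
    using tP t(2,3) nt unfolding pow cancelling_element_def by blast
  then show ?thesis unfolding D by blast
qed

text \<open>Were the image proper, a nontrivial character of \<open>A\<close> of order \<open>p\<close> would be trivial on it. Its
  pullback \<open>\<phi>\<close> to the normalizer is nontrivial, yet at an element \<open>u\<close> of \<open>P\<close> of least order
  with \<open>\<phi> u \<noteq> 1\<close> the character of the transfer takes the value \<open>\<phi> u\<close>.\<close>

lemma transfer_from_sylow_normalizer_surj:
  assumes fin: "finite (carrier G)" and p: "Factorial_Ring.prime p" and P: "sylow_subgroup p G P"
    and small: "\<And>R. sylow_subgroup p G R \<Longrightarrow> P \<noteq> R \<Longrightarrow> card (P \<inter> R) \<le> card (group_norm (G\<lparr>carrier := P\<rparr>))"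
    and A: "comm_group A" "order A = p ^ k"
    and \<theta>: "\<theta> \<in> hom (G\<lparr>carrier := normalizer G P\<rparr>) A" "\<theta> ` normalizer G P = carrier A"
  shows "transfer (normalizer G P) A \<theta> ` carrier G = carrier A"
proof (rule ccontr)
  assume ns: "transfer (normalizer G P) A \<theta> ` carrier G \<noteq> carrier A"
  interpret A: comm_group A by (rule A)
  have p0: "p > 0" using p by (rule prime_gt_0_nat)
  let ?N = "normalizer G P" and ?V = "transfer (normalizer G P) A \<theta>"
  have Ps: "subgroup P G" using P by (simp add: sylow_subgroup_def)
  have N: "subgroup ?N G" by (rule normalizer_imp_subgroup[OF subgroup.subset[OF Ps]])
  have PN: "P \<subseteq> ?N" by (rule subset_normalizer[OF fin Ps])
  interpret N: group "G\<lparr>carrier := ?N\<rparr>" by (rule subgroup_imp_group[OF N])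
  have V: "?V \<in> hom G A" by (rule transfer_hom[OF N A(1) \<theta>(1)])
  interpret V: group_hom G A ?V
    by (simp add: group_hom_def group_hom_axioms_def is_group A.is_group V)
  obtain \<chi> a where \<chi>: "linear_char p A (carrier A) \<chi>" and triv: "\<And>y. y \<in> ?V ` carrier G \<Longrightarrow> \<chi> y = 1"
    and a: "a \<in> carrier A" "\<chi> a \<noteq> 1"
    using A.nontrivial_char_trivial_on_proper_subgroup[OF p A(2) V.img_is_subgroup ns] by blast
  have \<theta>c: "\<theta> g \<in> carrier A" if "g \<in> ?N" for g using \<theta>(2) that by blast
  define \<phi> where "\<phi> g = \<chi> (\<theta> g)" for g
  have \<phi>: "linear_char p G ?N \<phi>"
    unfolding linear_char_def \<phi>_def
  proof (intro conjI ballI)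
    fix g h assume gh: "g \<in> ?N" "h \<in> ?N"
    then have "\<theta> (g \<otimes> h) = \<theta> g \<otimes>\<^bsub>A\<^esub> \<theta> h" using \<theta>(1) by (simp add: hom_def)
    then show "\<chi> (\<theta> (g \<otimes> h)) = \<chi> (\<theta> g) * \<chi> (\<theta> h)"
      using linear_char_mult[OF \<chi> \<theta>c[OF gh(1)] \<theta>c[OF gh(2)]] by simp
  next
    fix g assume "g \<in> ?N"
    then show "\<chi> (\<theta> g) ^ p = 1" using linear_char_power_eq_1[OF \<chi> \<theta>c] by simp
  qed
  note pow1 = sylow_pow_eq_one[OF P]
  \<comment> \<open>Choose \<open>u\<close> of least order in \<open>P\<close> with \<open>\<phi> u \<noteq> 1\<close>; such elements exist because \<open>P\<close> has index prime to \<open>p\<close> in its normalizer.\<close>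
  let ?Q = "\<lambda>m. \<exists>u\<in>P. u [^] (p ^ m :: nat) = \<one> \<and> \<phi> u \<noteq> 1"
  have "\<exists>m. ?Q m"
  proof -
    have "a \<in> \<theta> ` ?N" using a(1) \<theta>(2) by simp
    then obtain n where n: "n \<in> ?N" "\<theta> n = a" by auto
    let ?s = "card (rcosets\<^bsub>G\<lparr>carrier := ?N\<rparr>\<^esub> P)"
    have nP: "n [^] ?s \<in> P"
      using N.pow_index_mem_normal[OF subgroup_in_normalizer[OF Ps], of n] n(1)
      by (simp add: nat_pow_consistent[symmetric])
    have "\<phi> (n [^] ?s) \<noteq> 1"
    proof
      assume "\<phi> (n [^] ?s) = 1"
      then have 1: "\<phi> n ^ ?s = 1" using linear_char_pow[OF \<phi> p0 N n(1)] by simp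
      have 2: "\<phi> n ^ p = 1" by (rule linear_char_power_eq_1[OF \<phi> n(1)])
      have cop: "coprime ?s p" by (rule sylow_index_coprime(2)[OF fin p P N PN])
      obtain i j where "p * i = ?s * j + gcd p ?s" using bezout_nat[of p ?s] p0 by blast
      then have ij: "p * i = ?s * j + 1" using cop by (simp add: coprime_commute)
      have "\<phi> n = \<phi> n ^ (?s * j + 1)" using 1 by (simp add: power_mult)
      also have "\<dots> = 1" unfolding ij[symmetric] using 2 by (simp add: power_mult)
      finally show False using a(2) n(2) by (simp add: \<phi>_def)
    qed
    then show ?thesis using nP pow1[OF nP] by blast
  qed
  then have Qm: "?Q (LEAST m. ?Q m)" by (rule LeastI_ex)
  have minm: "\<not> ?Q j" if "j < (LEAST m. ?Q m)" for j using not_less_Least[OF that] .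
  obtain u where u: "u \<in> P" "u [^] (p ^ (LEAST m. ?Q m)) = \<one>" "\<phi> u \<noteq> 1" using Qm by blast
  have "(LEAST m. ?Q m) \<noteq> 0"
  proof
    assume "(LEAST m. ?Q m) = 0"
    then have "u = \<one>" using u(2) subgroup.mem_carrier[OF Ps u(1)] by simp
    then show False using u(3) linear_char_one[OF \<phi> p0 N] by simp
  qed
  then obtain m where m: "(LEAST m. ?Q m) = Suc m" using not0_implies_Suc by blast
  have small': "\<phi> w = 1" if "w \<in> ?N" "w [^] (p ^ m) = \<one>" for w
    using minm[of m] p_element_of_normalizer[OF fin p P that] that(2) unfolding m by blast
  have um: "u [^] (p ^ Suc m) = \<one>" using u(2) unfolding m .
  have uc: "u \<in> carrier G" using subgroup.mem_carrier[OF Ps u(1)] .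
  have "\<chi> (?V u) = (\<Prod>C\<in>rcosets ?N. \<phi> (transfer_factor C u))"
    unfolding transfer_def \<phi>_def
    by (rule linear_char_finprod[OF A(1) \<chi> p0]) (use transfer_factor_mem[OF N _ uc] \<theta>c in blast)
  also have "\<dots> = \<phi> u"
    by (rule transfer_char_value[OF p fin N Ps PN \<phi> u(1) um small'])
      (assumption | rule cancelling_element_in_sylow[OF fin p P small])+
  finally show False using triv[of "?V u"] uc u(3) by simp
qed

end

section \<open>Control of transfer\<close>

theorem corollary1p11:
  fixes G :: "('a, 'b) monoid_scheme" and p :: nat and P :: "'a set"
  assumes "group G" and "finite (carrier G)"
    and "Factorial_Ring.prime p" and "p dvd order G"
    and "\<And>Q R. sylow_subgroup p G Q \<Longrightarrow> sylow_subgroup p G R \<Longrightarrow> Q \<noteq> R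
           \<Longrightarrow> card (Q \<inter> R) \<le> card (group_norm (G\<lparr>carrier := Q\<rparr>))"
    and "sylow_subgroup p G P"
  shows "controls_p_transfer p G (normalizer G P)"
proof -
  note fin = assms(2) and p = assms(3) and P = assms(6)
  interpret group G by (rule assms(1))
  have Ps: "subgroup P G" using P by (simp add: sylow_subgroup_def)
  define N where "N = normalizer G P"
  define GN where "GN = G\<lparr>carrier := N\<rparr>"
  have N: "subgroup N G" unfolding N_def by (rule normalizer_imp_subgroup[OF subgroup.subset[OF Ps]])
  have PN: "P \<subseteq> N" unfolding N_def by (rule subset_normalizer[OF fin Ps])
  have finN: "finite N" using finite_subset[OF subgroup.subset[OF N] fin] .
  have cN: "carrier GN = N" by (simp add: GN_def)
  interpret N: group GN unfolding GN_def by (rule subgroup_imp_group[OF N])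
  have cop: "coprime (card (rcosets\<^bsub>G\<^esub> N)) p" by (rule sylow_index_coprime(1)[OF fin p P N PN])
  define R where "R = p_abelian_residual p GN"
  define K where "K = p_abelian_residual p G"
  have finGN: "finite (carrier GN)" using finN cN by simp
  have R: "abelian_p_quotient p GN R" unfolding R_def by (rule N.p_abelian_residual_least(1)[OF finGN p])
  have Rmin: "R \<subseteq> M" if "abelian_p_quotient p GN M" for M
    unfolding R_def by (rule N.p_abelian_residual_least(2)[OF finGN p that])
  have K: "abelian_p_quotient p G K" unfolding K_def by (rule p_abelian_residual_least(1)[OF fin p])
  have Kmin: "K \<subseteq> M" if "abelian_p_quotient p G M" for M
    unfolding K_def by (rule p_abelian_residual_least(2)[OF fin p that])
  interpret R: normal R GN using R by (simp add: abelian_p_quotient_def)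
  interpret K: normal K G using K by (simp add: abelian_p_quotient_def)
  let ?A = "GN Mod R" and ?B = "G Mod K"
  obtain k where A: "comm_group ?A" "order ?A = p ^ k" using R by (auto simp: abelian_p_quotient_def)
  obtain l where B: "comm_group ?B" "order ?B = p ^ l" using K by (auto simp: abelian_p_quotient_def)
  interpret A: comm_group ?A by (rule A)
  interpret B: comm_group ?B by (rule B)

  \<comment> \<open>The transfer bounds the order of \<open>?B\<close> from below by that of \<open>?A\<close>.\<close>
  define V where "V = transfer N ?A (\<lambda>x. R #>\<^bsub>GN\<^esub> x)"
  have \<theta>: "(\<lambda>x. R #>\<^bsub>GN\<^esub> x) \<in> hom GN ?A" by (rule R.r_coset_hom_Mod)
  have \<theta>s: "(\<lambda>x. R #>\<^bsub>GN\<^esub> x) ` N = carrier ?A" by (auto simp: FactGroup_def RCOSETS_def cN)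
  have Vs: "V ` carrier G = carrier ?A"
    unfolding V_def
    by (rule transfer_from_sylow_normalizer_surj[OF fin p P assms(5)[OF P] A, folded N_def, folded GN_def])
      (rule \<theta> \<theta>s | assumption)+
  have V: "V \<in> hom G ?A"
    unfolding V_def by (rule transfer_hom[OF N A(1), folded GN_def, OF \<theta>])
  interpret V: group_hom G ?A V
    by (simp add: group_hom_def group_hom_axioms_def is_group A.is_group V)
  let ?L = "kernel G ?A V"
  note Lq = abelian_p_quotient_kernel[OF V.group_hom_axioms p A]
  interpret L: normal ?L G by (rule V.normal_kernel)
  have KL: "K \<subseteq> ?L" by (rule Kmin[OF Lq(1)])

  \<comment> \<open>The restriction to \<open>N\<close> of the projection onto \<open>?B\<close> gives the opposite bound.\<close>
  have \<psi>: "(\<lambda>x. K #>\<^bsub>G\<^esub> x) \<in> hom GN ?B"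
    using K.r_coset_hom_Mod subgroup.mem_carrier[OF N] by (auto simp: hom_def GN_def)
  interpret \<psi>: group_hom GN ?B "\<lambda>x. K #>\<^bsub>G\<^esub> x"
    by (simp add: group_hom_def group_hom_axioms_def N.is_group B.is_group \<psi>)
  let ?M = "kernel GN ?B (\<lambda>x. K #>\<^bsub>G\<^esub> x)"
  note Mq = N.abelian_p_quotient_kernel[OF \<psi>.group_hom_axioms p B]
  interpret M: normal ?M GN by (rule \<psi>.normal_kernel)
  have Mi: "?M = N \<inter> K"
  proof -
    have "K #>\<^bsub>G\<^esub> x = K \<longleftrightarrow> x \<in> K" if "x \<in> N" for x
      using subgroup.mem_carrier[OF N that] K.rcos_const rcos_self[OF _ K.is_subgroup] by blast
    then show ?thesis by (auto simp: kernel_def cN FactGroup_def)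
  qed
  have RM: "R \<subseteq> ?M" by (rule Rmin[OF Mq(1)])

  have oN: "order GN = card N" by (simp add: order_def cN)
  have quot: "order (H Mod S) * card S = order H" if "S \<lhd> H" for S and H :: "('a, 'b) monoid_scheme"
    using group.lagrange[OF normal.axioms(2)[OF that] normal.axioms(1)[OF that]]
    by (simp add: order_def FactGroup_def)
  have 1: "order ?A * card R = card N" using quot[OF R.normal_axioms] oN by simp
  have 2: "order (GN Mod ?M) * card ?M = card N" using quot[OF M.normal_axioms] oN by simp
  have 3: "order ?B * card K = order G" by (rule quot[OF K.normal_axioms])
  have 4: "order (G Mod ?L) * card ?L = order G" by (rule quot[OF L.normal_axioms])
  have 5: "card (rcosets\<^bsub>G\<^esub> N) * card N = order G" by (rule lagrange[OF N])
  have 6: "order (G Mod ?L) = order ?A" using Lq(2) Vs by (simp add: order_def)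
  have oG: "order G > 0" using fin order_gt_0_iff_finite by simp
  have "card N \<noteq> 0" using finN subgroup.one_closed[OF N] by auto
  let ?I = "(\<lambda>x. K #>\<^bsub>G\<^esub> x) ` carrier GN"
  have 7: "order (GN Mod ?M) = card ?I" by (rule Mq(2))
  have I: "card (rcosets\<^bsub>?B\<^esub> ?I) * card ?I = order ?B" by (rule B.lagrange[OF \<psi>.img_is_subgroup])
  have "card (rcosets\<^bsub>?B\<^esub> ?I) dvd p ^ l" using I unfolding B(2) by (rule dvdI[OF sym])
  then obtain j where j: "card (rcosets\<^bsub>?B\<^esub> ?I) = p ^ j" unfolding divides_primepow_nat[OF p] by blast
  have "subgroup ?M (G\<lparr>carrier := K\<rparr>)"
    unfolding Mi by (rule subgroup_incl[OF subgroups_Inter_pair[OF N K.subgroup_axioms] K.subgroup_axioms]) simp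
  then have "card (rcosets\<^bsub>G\<lparr>carrier := K\<rparr>\<^esub> ?M) * card ?M = card K"
    using group.lagrange[OF subgroup_imp_group[OF K.subgroup_axioms]] by (simp add: order_def)
  then have "card ?M dvd card K" by (metis dvd_triv_right)
  then obtain c where c: "card K = card ?M * c" by (rule dvdE)
  \<comment> \<open>The image of \<open>N\<close> in \<open>?B\<close> has index \<open>p ^ j\<close>, which divides the index of \<open>N\<close>; hence \<open>j = 0\<close>.\<close>
  have "card (rcosets\<^bsub>G\<^esub> N) * card N = p ^ j * c * card N"
  proof -
    have "card (rcosets\<^bsub>G\<^esub> N) * card N = p ^ j * card ?I * (card ?M * c)"
      unfolding 5 3[symmetric] I[symmetric] j c ..
    also have "\<dots> = p ^ j * c * (card ?I * card ?M)" by (simp add: ac_simps)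
    also have "card ?I * card ?M = card N" using 2 unfolding 7 .
    finally show ?thesis .
  qed
  then have "card (rcosets\<^bsub>G\<^esub> N) = p ^ j * c" using \<open>card N \<noteq> 0\<close> by simp
  then have "coprime (p ^ j) p" using cop by simp
  then have "j = 0" using p by (cases j) (auto simp: not_prime_unit)
  then have BI: "order ?B = card ?I" using I j by simp
  have Mpos: "card ?M > 0" using 2 \<open>card N \<noteq> 0\<close> by (intro gr0I) simp
  have Apos: "order ?A > 0" using 4 6 oG by (intro gr0I) simp
  have "order ?B * card ?M = order ?A * card R" using 1 2 BI 7 by simp
  also have "\<dots> \<le> order ?A * card ?M"
    using card_mono[OF finite_subset[OF _ finGN] RM] subgroup.subset[OF M.subgroup_axioms] by simp
  finally have BA: "order ?B \<le> order ?A"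
    using Mpos by simp
  have "order ?A * card ?L = order ?B * card K" using 3 4 6 by simp
  also have "\<dots> \<le> order ?A * card K" using BA by simp
  finally have "card ?L \<le> card K"
    using Apos by simp
  then have KeqL: "K = ?L"
    using KL card_seteq[OF finite_subset[OF subgroup.subset[OF L.subgroup_axioms] fin]] by blast
  have "G Mod K \<cong> ?A" using V.FactGroup_iso[OF Vs] KeqL by simp
  then have "?A \<cong> G Mod K" by (rule B.iso_sym)
  then show ?thesis
    using N cop unfolding controls_p_transfer_def N_def[symmetric] GN_def[symmetric]
      R_def[symmetric] K_def[symmetric] by simp
qed

end
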